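(* If a 3-dimensional quasi-para-Sasakian manifold $(M,\varphi,\eta,\xi,g)$ has $\eta$-parallel Ricci tensor, then it is locally $\varphi$-symmetric.
   Context: An almost paracontact metric manifold $(M,\varphi,\eta,\xi,g)$ is a smooth manifold $M$ of dimension $2n+1$ ($n\ge 1$; here $n=1$) with a $(1,1)$-tensor field $\varphi$, a vector field $\xi$, a 1-form $\eta$ and a pseudo-Riemannian metric $g$ such that $\varphi\xi=0$, $\eta\circ\varphi=0$, $\eta(\xi)=1$, $\varphi^2=\mathrm{id}-\eta\otimes\xi$, $\varphi$ induces an almost paracomplex structure on each fibre of $\mathbb D=\ker\eta$, and $g(\varphi X,\varphi Y)=-g(X,Y)+\eta(X)\eta(Y)$ for all $X,Y$ (hence $\eta(X)=g(X,\xi)$ and $g$ has signature $(n+1,n)$). It is quasi-para-Sasakian if $(\nabla_X\varphi)Y=g(X,Y)\xi-\eta(Y)X$ for all vector fields $X,Y$, where $\nabla$ is the Levi-Civita connection of $g$. The curvature tensor is $R(X,Y)Z=\nabla_X\nabla_YZ-\nabla_Y\nabla_XZ-\nabla_{[X,Y]}Z$, and $\mathrm{Ric}(Y,Z)=\mathrm{tr}(X\mapsto R(X,Y)Z)$. The Ricci tensor is called $\eta$-parallel if $(\nabla_X\mathrm{Ric})(\varphi Y,\varphi Z)=0$ for all vector fields $X,Y,Z$. The structure is locally $\varphi$-symmetric if $\varphi^2\big((\nabla_WR)(X,Y)Z\big)=0$ for all vector fields $W,X,Y,Z$ orthogonal to $\xi$. *)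

theory Defs
  imports "HOL-Analysis.Analysis"
begin

section \<open>Smooth maps between normed spaces\<close>

text \<open>Only used on open sets \<open>S\<close>: derivatives are two-sided, taken at the points of \<open>S\<close>.  In finite dimension,
  \<open>C^(k+1)\<close> means differentiable with all directional derivatives \<open>C^k\<close>.\<close>

primrec Ck_on :: "nat \<Rightarrow> ('a::real_normed_vector \<Rightarrow> 'b::real_normed_vector) \<Rightarrow> 'a set \<Rightarrow> bool"
where
  "Ck_on 0 f S \<longleftrightarrow> continuous_on S f"
| "Ck_on (Suc k) f S \<longleftrightarrow>
     (\<forall>x\<in>S. f differentiable (at x)) \<and>
     (\<forall>v. Ck_on k (\<lambda>x. frechet_derivative f (at x) v) S)"

definition smooth_on :: "('a::real_normed_vector \<Rightarrow> 'b::real_normed_vector) \<Rightarrow> 'a set \<Rightarrow> bool"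
  where "smooth_on f S \<longleftrightarrow> (\<forall>k. Ck_on k f S)"

section \<open>Smooth manifolds\<close>

text \<open>
  The manifold is the whole type \<open>'m\<close>, a second countable Hausdorff space; its smooth structure is
  given by an atlas of charts \<open>(U, x)\<close> with \<open>x\<close> mapping \<open>U\<close> into \<open>real ^ 'n\<close>.  The values of
  \<open>x\<close> outside \<open>U\<close> are irrelevant.
\<close>

type_synonym ('m, 'n) chart = "'m set \<times> ('m \<Rightarrow> real ^ 'n)"

definition is_chart :: "('m::topological_space, 'n::finite) chart \<Rightarrow> bool" where
  "is_chart c \<longleftrightarrow> (case c of (U, x) \<Rightarrow>
     open U \<and> open (x ` U) \<and> homeomorphism U (x ` U) x (inv_into U x))"

definition smooth_atlas ::
  "('m::{t2_space, second_countable_topology}, 'n::finite) chart set \<Rightarrow> bool" where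
  "smooth_atlas A \<longleftrightarrow>
     (\<forall>c\<in>A. is_chart c) \<and> (\<Union>c\<in>A. fst c) = UNIV \<and>
     (\<forall>(U, x)\<in>A. \<forall>(V, y)\<in>A. smooth_on (y \<circ> inv_into U x) (x ` (U \<inter> V)))"

definition smooth_map_on ::
  "('m::topological_space, 'n::finite) chart set \<Rightarrow> 'm set \<Rightarrow> ('m \<Rightarrow> 'b::real_normed_vector) \<Rightarrow> bool"
  where "smooth_map_on A W f \<longleftrightarrow> (\<forall>(U, x)\<in>A. smooth_on (f \<circ> inv_into U x) (x ` (U \<inter> W)))"

definition smooth_fun ::
  "('m::topological_space, 'n::finite) chart set \<Rightarrow> ('m \<Rightarrow> real) \<Rightarrow> bool" where
  "smooth_fun A f \<longleftrightarrow> smooth_map_on A UNIV f"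

text \<open>
  Every tangent space is identified with \<open>real ^ 'n\<close> by means of one chosen chart around the
  base point: \<open>v\<close> at \<open>p\<close> is the tangent vector whose components in the chart \<open>chart_at A p\<close>
  are the entries of \<open>v\<close>.  The differential \<open>dif A f p\<close> at \<open>p\<close> of a map \<open>f\<close> is expressed through
  this identification; for a chart \<open>(V, y)\<close> around \<open>p\<close>, the components of \<open>v\<close> with respect to
  \<open>(V, y)\<close> are those of \<open>dif A y p v\<close>.
\<close>

definition chart_at ::
  "('m::topological_space, 'n::finite) chart set \<Rightarrow> 'm \<Rightarrow> ('m, 'n) chart" where
  "chart_at A p = (SOME c. c \<in> A \<and> p \<in> fst c)"

definition dif ::
  "('m::topological_space, 'n::finite) chart set \<Rightarrow> ('m \<Rightarrow> 'b::real_normed_vector) \<Rightarrow>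
   'm \<Rightarrow> real ^ 'n \<Rightarrow> 'b" where
  "dif A f p v = (case chart_at A p of (U, x) \<Rightarrow> frechet_derivative (f \<circ> inv_into U x) (at (x p)) v)"

section \<open>Vector fields and tensor fields\<close>

type_synonym ('m, 'n) vfield = "'m \<Rightarrow> real ^ 'n"

definition smooth_vf ::
  "('m::topological_space, 'n::finite) chart set \<Rightarrow> ('m, 'n) vfield \<Rightarrow> bool" where
  "smooth_vf A X \<longleftrightarrow> (\<forall>(V, y)\<in>A. smooth_map_on A V (\<lambda>p. dif A y p (X p)))"

definition vf_apply ::
  "('m::topological_space, 'n::finite) chart set \<Rightarrow> ('m, 'n) vfield \<Rightarrow> ('m \<Rightarrow> real) \<Rightarrow> 'm \<Rightarrow> real" where
  "vf_apply A X f = (\<lambda>p. dif A f p (X p))"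

definition lie_bracket ::
  "('m::topological_space, 'n::finite) chart set \<Rightarrow>
   ('m, 'n) vfield \<Rightarrow> ('m, 'n) vfield \<Rightarrow> ('m, 'n) vfield" where
  "lie_bracket A X Y = (\<lambda>p. THE v. \<forall>f. smooth_fun A f \<longrightarrow>
     dif A f p v = vf_apply A X (vf_apply A Y f) p - vf_apply A Y (vf_apply A X f) p)"

definition smooth_one_form ::
  "('m::topological_space, 'n::finite) chart set \<Rightarrow> ('m \<Rightarrow> real ^ 'n \<Rightarrow> real) \<Rightarrow> bool" where
  "smooth_one_form A \<eta> \<longleftrightarrow>
     (\<forall>p. linear (\<eta> p)) \<and> (\<forall>X. smooth_vf A X \<longrightarrow> smooth_fun A (\<lambda>p. \<eta> p (X p)))"

definition smooth_endo ::
  "('m::topological_space, 'n::finite) chart set \<Rightarrow> ('m \<Rightarrow> real ^ 'n \<Rightarrow> real ^ 'n) \<Rightarrow> bool" where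
  "smooth_endo A \<phi> \<longleftrightarrow>
     (\<forall>p. linear (\<phi> p)) \<and> (\<forall>X. smooth_vf A X \<longrightarrow> smooth_vf A (\<lambda>p. \<phi> p (X p)))"

text \<open>No signature is prescribed; for an almost paracontact metric structure it is forced to be
  \<open>(n+1, n)\<close> by compatibility with \<open>\<phi>\<close>.\<close>

definition pseudo_riemannian ::
  "('m::topological_space, 'n::finite) chart set \<Rightarrow>
   ('m \<Rightarrow> real ^ 'n \<Rightarrow> real ^ 'n \<Rightarrow> real) \<Rightarrow> bool" where
  "pseudo_riemannian A g \<longleftrightarrow>
     (\<forall>p. bilinear (g p)) \<and>
     (\<forall>p v w. g p v w = g p w v) \<and>
     (\<forall>p v. (\<forall>w. g p v w = 0) \<longrightarrow> v = 0) \<and>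
     (\<forall>X Y. smooth_vf A X \<longrightarrow> smooth_vf A Y \<longrightarrow> smooth_fun A (\<lambda>p. g p (X p) (Y p)))"

section \<open>Levi-Civita connection and curvature\<close>

type_synonym ('m, 'n) conn = "('m, 'n) vfield \<Rightarrow> ('m, 'n) vfield \<Rightarrow> ('m, 'n) vfield"

text \<open>Connections are only constrained on smooth arguments; \<open>nab X Y\<close> is \<open>\<nabla>\<^sub>X Y\<close>.\<close>

definition affine_connection ::
  "('m::topological_space, 'n::finite) chart set \<Rightarrow> ('m, 'n) conn \<Rightarrow> bool" where
  "affine_connection A nab \<longleftrightarrow>
     (\<forall>X Y. smooth_vf A X \<longrightarrow> smooth_vf A Y \<longrightarrow> smooth_vf A (nab X Y)) \<and>
     (\<forall>X X' Y. smooth_vf A X \<longrightarrow> smooth_vf A X' \<longrightarrow> smooth_vf A Y \<longrightarrow>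
        nab (\<lambda>p. X p + X' p) Y = (\<lambda>p. nab X Y p + nab X' Y p)) \<and>
     (\<forall>f X Y. smooth_fun A f \<longrightarrow> smooth_vf A X \<longrightarrow> smooth_vf A Y \<longrightarrow>
        nab (\<lambda>p. f p *\<^sub>R X p) Y = (\<lambda>p. f p *\<^sub>R nab X Y p)) \<and>
     (\<forall>X Y Y'. smooth_vf A X \<longrightarrow> smooth_vf A Y \<longrightarrow> smooth_vf A Y' \<longrightarrow>
        nab X (\<lambda>p. Y p + Y' p) = (\<lambda>p. nab X Y p + nab X Y' p)) \<and>
     (\<forall>f X Y. smooth_fun A f \<longrightarrow> smooth_vf A X \<longrightarrow> smooth_vf A Y \<longrightarrow>
        nab X (\<lambda>p. f p *\<^sub>R Y p) = (\<lambda>p. vf_apply A X f p *\<^sub>R Y p + f p *\<^sub>R nab X Y p))"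

definition levi_civita ::
  "('m::topological_space, 'n::finite) chart set \<Rightarrow>
   ('m \<Rightarrow> real ^ 'n \<Rightarrow> real ^ 'n \<Rightarrow> real) \<Rightarrow> ('m, 'n) conn \<Rightarrow> bool" where
  "levi_civita A g nab \<longleftrightarrow>
     affine_connection A nab \<and>
     (\<forall>X Y. smooth_vf A X \<longrightarrow> smooth_vf A Y \<longrightarrow>
        (\<forall>p. nab X Y p - nab Y X p = lie_bracket A X Y p)) \<and>
     (\<forall>X Y Z. smooth_vf A X \<longrightarrow> smooth_vf A Y \<longrightarrow> smooth_vf A Z \<longrightarrow>
        (\<forall>p. vf_apply A X (\<lambda>q. g q (Y q) (Z q)) p = g p (nab X Y p) (Z p) + g p (Y p) (nab X Z p)))"

definition curvature ::
  "('m::topological_space, 'n::finite) chart set \<Rightarrow> ('m, 'n) conn \<Rightarrow>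
   ('m, 'n) vfield \<Rightarrow> ('m, 'n) vfield \<Rightarrow> ('m, 'n) vfield \<Rightarrow> ('m, 'n) vfield" where
  "curvature A nab X Y Z =
     (\<lambda>p. nab X (nab Y Z) p - nab Y (nab X Z) p - nab (lie_bracket A X Y) Z p)"

text \<open>
  Since the curvature is tensorial, the endomorphism \<open>v \<mapsto> R(v, Y)Z\<close> of the tangent space at \<open>p\<close>
  may be computed by extending \<open>v\<close> to an arbitrary smooth vector field.
\<close>

definition extend_vec ::
  "('m::topological_space, 'n::finite) chart set \<Rightarrow> 'm \<Rightarrow> real ^ 'n \<Rightarrow> ('m, 'n) vfield" where
  "extend_vec A p v = (SOME X. smooth_vf A X \<and> X p = v)"

definition ricci ::
  "('m::topological_space, 'n::finite) chart set \<Rightarrow> ('m, 'n) conn \<Rightarrow>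
   ('m, 'n) vfield \<Rightarrow> ('m, 'n) vfield \<Rightarrow> 'm \<Rightarrow> real" where
  "ricci A nab Y Z = (\<lambda>p. trace (matrix (\<lambda>v. curvature A nab (extend_vec A p v) Y Z p)))"

definition nabla_endo ::
  "('m, 'n::finite) conn \<Rightarrow> ('m \<Rightarrow> real ^ 'n \<Rightarrow> real ^ 'n) \<Rightarrow>
   ('m, 'n) vfield \<Rightarrow> ('m, 'n) vfield \<Rightarrow> ('m, 'n) vfield" where
  "nabla_endo nab \<phi> X Y = (\<lambda>p. nab X (\<lambda>q. \<phi> q (Y q)) p - \<phi> p (nab X Y p))"

definition nabla_ricci ::
  "('m::topological_space, 'n::finite) chart set \<Rightarrow> ('m, 'n) conn \<Rightarrow>
   ('m, 'n) vfield \<Rightarrow> ('m, 'n) vfield \<Rightarrow> ('m, 'n) vfield \<Rightarrow> 'm \<Rightarrow> real" where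
  "nabla_ricci A nab X Y Z =
     (\<lambda>p. vf_apply A X (ricci A nab Y Z) p - ricci A nab (nab X Y) Z p - ricci A nab Y (nab X Z) p)"

definition nabla_curvature ::
  "('m::topological_space, 'n::finite) chart set \<Rightarrow> ('m, 'n) conn \<Rightarrow> ('m, 'n) vfield \<Rightarrow>
   ('m, 'n) vfield \<Rightarrow> ('m, 'n) vfield \<Rightarrow> ('m, 'n) vfield \<Rightarrow> ('m, 'n) vfield" where
  "nabla_curvature A nab W X Y Z =
     (\<lambda>p. nab W (curvature A nab X Y Z) p - curvature A nab (nab W X) Y Z p
          - curvature A nab X (nab W Y) Z p - curvature A nab X Y (nab W Z) p)"

section \<open>Almost paracontact metric structures\<close>

definition paracomplex_on :: "(real ^ 'n::finite) set \<Rightarrow> (real ^ 'n \<Rightarrow> real ^ 'n) \<Rightarrow> bool" where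
  "paracomplex_on D J \<longleftrightarrow>
     (\<forall>v\<in>D. J v \<in> D \<and> J (J v) = v) \<and> dim {v \<in> D. J v = v} = dim {v \<in> D. J v = - v}"

definition almost_paracontact_metric ::
  "('m::{t2_space, second_countable_topology}, 'n::finite) chart set \<Rightarrow>
   ('m \<Rightarrow> real ^ 'n \<Rightarrow> real ^ 'n) \<Rightarrow> ('m \<Rightarrow> real ^ 'n \<Rightarrow> real) \<Rightarrow> ('m, 'n) vfield \<Rightarrow>
   ('m \<Rightarrow> real ^ 'n \<Rightarrow> real ^ 'n \<Rightarrow> real) \<Rightarrow> bool" where
  "almost_paracontact_metric A \<phi> \<eta> \<xi> g \<longleftrightarrow>
     (\<exists>n\<ge>1. CARD('n) = 2 * n + 1) \<and>
     smooth_atlas A \<and> smooth_endo A \<phi> \<and> smooth_one_form A \<eta> \<and> smooth_vf A \<xi> \<and>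
     pseudo_riemannian A g \<and>
     (\<forall>p. \<phi> p (\<xi> p) = 0) \<and>
     (\<forall>p v. \<eta> p (\<phi> p v) = 0) \<and>
     (\<forall>p. \<eta> p (\<xi> p) = 1) \<and>
     (\<forall>p v. \<phi> p (\<phi> p v) = v - \<eta> p v *\<^sub>R \<xi> p) \<and>
     (\<forall>p. paracomplex_on {v. \<eta> p v = 0} (\<phi> p)) \<and>
     (\<forall>p v w. g p (\<phi> p v) (\<phi> p w) = - g p v w + \<eta> p v * \<eta> p w)"

definition quasi_para_Sasakian ::
  "('m::{t2_space, second_countable_topology}, 'n::finite) chart set \<Rightarrow>
   ('m \<Rightarrow> real ^ 'n \<Rightarrow> real ^ 'n) \<Rightarrow> ('m \<Rightarrow> real ^ 'n \<Rightarrow> real) \<Rightarrow> ('m, 'n) vfield \<Rightarrow>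
   ('m \<Rightarrow> real ^ 'n \<Rightarrow> real ^ 'n \<Rightarrow> real) \<Rightarrow> ('m, 'n) conn \<Rightarrow> bool" where
  "quasi_para_Sasakian A \<phi> \<eta> \<xi> g nab \<longleftrightarrow>
     almost_paracontact_metric A \<phi> \<eta> \<xi> g \<and> levi_civita A g nab \<and>
     (\<forall>X Y. smooth_vf A X \<longrightarrow> smooth_vf A Y \<longrightarrow>
        (\<forall>p. nabla_endo nab \<phi> X Y p = g p (X p) (Y p) *\<^sub>R \<xi> p - \<eta> p (Y p) *\<^sub>R X p))"

definition eta_parallel_ricci ::
  "('m::topological_space, 'n::finite) chart set \<Rightarrow>
   ('m \<Rightarrow> real ^ 'n \<Rightarrow> real ^ 'n) \<Rightarrow> ('m, 'n) conn \<Rightarrow> bool" where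
  "eta_parallel_ricci A \<phi> nab \<longleftrightarrow>
     (\<forall>X Y Z. smooth_vf A X \<longrightarrow> smooth_vf A Y \<longrightarrow> smooth_vf A Z \<longrightarrow>
        (\<forall>p. nabla_ricci A nab X (\<lambda>q. \<phi> q (Y q)) (\<lambda>q. \<phi> q (Z q)) p = 0))"

definition horizontal_vf ::
  "('m::topological_space, 'n::finite) chart set \<Rightarrow>
   ('m \<Rightarrow> real ^ 'n \<Rightarrow> real ^ 'n \<Rightarrow> real) \<Rightarrow> ('m, 'n) vfield \<Rightarrow> ('m, 'n) vfield \<Rightarrow> bool" where
  "horizontal_vf A g \<xi> X \<longleftrightarrow> smooth_vf A X \<and> (\<forall>p. g p (X p) (\<xi> p) = 0)"

definition locally_phi_symmetric ::
  "('m::topological_space, 'n::finite) chart set \<Rightarrow>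
   ('m \<Rightarrow> real ^ 'n \<Rightarrow> real ^ 'n) \<Rightarrow> ('m, 'n) vfield \<Rightarrow>
   ('m \<Rightarrow> real ^ 'n \<Rightarrow> real ^ 'n \<Rightarrow> real) \<Rightarrow> ('m, 'n) conn \<Rightarrow> bool" where
  "locally_phi_symmetric A \<phi> \<xi> g nab \<longleftrightarrow>
     (\<forall>W X Y Z. horizontal_vf A g \<xi> W \<longrightarrow> horizontal_vf A g \<xi> X \<longrightarrow>
        horizontal_vf A g \<xi> Y \<longrightarrow> horizontal_vf A g \<xi> Z \<longrightarrow>
        (\<forall>p. \<phi> p (\<phi> p (nabla_curvature A nab W X Y Z p)) = 0))"

end

theory Submission imports Defs begin

text \<open>
  The structure equation gives \<open>\<nabla>\<^sub>X \<xi> = \<phi> X\<close> and \<open>R(X, Y)\<xi> = \<eta>(X)Y - \<eta>(Y)X\<close>; with the symmetries of the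
  curvature this determines all components of \<open>R\<close> involving \<open>\<xi>\<close>.  Near a point choose a horizontal
  field \<open>E\<close> with \<open>g(E, E) \<noteq> 0\<close>, so that \<open>E, \<phi>E, \<xi>\<close> is an orthogonal frame.  Differentiating the trace
  that defines the Ricci tensor in this frame, the contributions of \<open>\<xi>\<close> cancel, and for horizontal
  \<open>Y, Z\<close>
  \<open>g(E, E) (\<nabla>\<^sub>W Ric)(Y, Z) = g((\<nabla>\<^sub>W R)(E, Y)Z, E) - g((\<nabla>\<^sub>W R)(\<phi>E, Y)Z, \<phi>E)\<close>.
  The left-hand side vanishes by \<open>\<eta>\<close>-parallelism.  Taking \<open>Y = E\<close> and \<open>Y = \<phi>E\<close>, skew-symmetry shows that
  \<open>(\<nabla>\<^sub>W R)(E, \<phi>E)Z\<close> is orthogonal to \<open>E\<close> and \<open>\<phi>E\<close>, hence a multiple of \<open>\<xi>\<close>; as the horizontal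
  plane is two-dimensional, so is every \<open>(\<nabla>\<^sub>W R)(X, Y)Z\<close>.
\<close>

section \<open>Calculus of smooth maps on open sets\<close>

text \<open>The metric is indefinite, and E is a global field guaranteed to be non-null only near
  the chosen point. So E is never normalised: frame identities are multiplied by
  \<open>g E E\<close>, which avoids square roots and a split on the sign; the minus signs come from
  g(\<phi>E, \<phi>E) = -g(E, E). The price is that \<open>ricci\<close>, a pointwise trace, is
  differentiated as a quotient of two smooth functions, and the derivative of \<open>g E E\<close>
  has to be accounted for.

  The \<xi> contributions disappear for three reasons. For horizontal Y, Z the vector R(\<xi>, Y)Z
  is orthogonal to the horizontal plane; R(E, Y)Z has no \<xi> component; and the diagonal entry of
  the trace belonging to \<xi> is -g(Y, Z), whose covariant derivative is zero.

  \<eta>-parallelism speaks of \<phi>Y and \<phi>Z only, but \<phi> is an involution on horizontal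
  vectors, so these are all horizontal fields.

  A connection acts on global fields, whereas the argument compares values at one point. Hence the
  long preparation: bump functions, extension of vectors, tensoriality, and independence of the
  chart chosen to identify each tangent space.\<close>

lemma Ck_on_subset: "Ck_on k f S \<Longrightarrow> T \<subseteq> S \<Longrightarrow> Ck_on k f T"
  by (induction k arbitrary: f) (auto intro: continuous_on_subset)

lemma frechet_derivative_cong_open:
  assumes "open S" "x \<in> S" "\<And>y. y \<in> S \<Longrightarrow> f y = g y"
  shows "frechet_derivative f (at x) = frechet_derivative g (at x)"
proof -
  have "(f has_derivative D) (at x) \<longleftrightarrow> (g has_derivative D) (at x)" for D
    using assms by (metis has_derivative_transform_within_open)
  then show ?thesis by (simp add: frechet_derivative_def)
qed

lemma Ck_on_cong:
  assumes "open S" "\<And>x. x \<in> S \<Longrightarrow> f x = g x" "Ck_on k f S"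
  shows "Ck_on k g S"
  using assms(2,3)
proof (induction k arbitrary: f g)
  case 0
  then show ?case by (metis Ck_on.simps(1) continuous_on_cong)
next
  case (Suc k)
  have eq: "frechet_derivative f (at x) v = frechet_derivative g (at x) v" if "x \<in> S" for x v
    using frechet_derivative_cong_open[OF assms(1) that] Suc.prems(1) by metis
  have "g differentiable at x" if "x \<in> S" for x
    using Suc.prems that assms(1)
    by (metis Ck_on.simps(2) differentiable_def has_derivative_transform_within_open)
  moreover have "Ck_on k (\<lambda>x. frechet_derivative g (at x) v) S" for v
    using Suc.IH[of "\<lambda>x. frechet_derivative f (at x) v"] eq Suc.prems(2) by auto
  ultimately show ?case by simp
qed

text \<open>Entry point of the closure proofs: a derivative found by the usual rules replaces
  \<open>frechet_derivative\<close>, by uniqueness.\<close>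

lemma Ck_on_SucI:
  assumes "open S" "\<And>x. x \<in> S \<Longrightarrow> (f has_derivative f' x) (at x)"
    "\<And>v. Ck_on k (\<lambda>x. f' x v) S"
  shows "Ck_on (Suc k) f S"
proof -
  have *: "f' x v = frechet_derivative f (at x) v" if "x \<in> S" for x v
    using assms(2)[OF that] frechet_derivative_at by metis
  have "Ck_on k (\<lambda>x. frechet_derivative f (at x) v) S" for v
    by (rule Ck_on_cong[OF assms(1) *[where v = v] assms(3)[of v]])
  then show ?thesis using assms(2) by (auto simp: differentiable_def)
qed

lemma Ck_on_SucD: "Ck_on (Suc k) f S \<Longrightarrow> Ck_on k f S"
proof (induction k arbitrary: f)
  case 0
  then show ?case
    by (auto intro!: continuous_at_imp_continuous_on differentiable_imp_continuous_within)
qed simp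

lemma Ck_on_Suc_has_derivative:
  "Ck_on (Suc k) f S \<Longrightarrow> x \<in> S \<Longrightarrow> (f has_derivative frechet_derivative f (at x)) (at x)"
  by (simp add: frechet_derivative_works)

lemma Ck_on_local:
  assumes "\<And>x. x \<in> S \<Longrightarrow> \<exists>T. open T \<and> x \<in> T \<and> Ck_on k f T"
  shows "Ck_on k f S"
  using assms
proof (induction k arbitrary: f)
  case 0
  show ?case unfolding Ck_on.simps
  proof (rule continuous_at_imp_continuous_on, rule ballI)
    fix x assume "x \<in> S"
    then obtain T where "open T" "x \<in> T" "Ck_on 0 f T" using 0 by blast
    then show "isCont f x" by (simp add: continuous_on_eq_continuous_at)
  qed
next
  case (Suc k)
  have "Ck_on k (\<lambda>x. frechet_derivative f (at x) v) S" for v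
    by (rule Suc.IH) (use Suc.prems in \<open>auto; blast\<close>)
  moreover have "f differentiable at x" if "x \<in> S" for x
    using Suc.prems[OF that] by auto
  ultimately show ?case by simp
qed

lemma Ck_on_const: "Ck_on k (\<lambda>x. c) S"
  by (induction k arbitrary: c) simp_all

lemma Ck_on_bounded_linear:
  assumes "open S" "bounded_linear f" shows "Ck_on k f S"
proof (cases k)
  case 0
  then show ?thesis by (simp add: linear_continuous_on assms)
next
  case (Suc m)
  show ?thesis unfolding Suc
    by (rule Ck_on_SucI[where f' = "\<lambda>_. f"])
       (auto simp: assms bounded_linear_imp_has_derivative Ck_on_const)
qed

lemma Ck_on_add:
  assumes "open S"
  shows "Ck_on k f S \<Longrightarrow> Ck_on k g S \<Longrightarrow> Ck_on k (\<lambda>x. f x + g x) S"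
proof (induction k arbitrary: f g)
  case 0
  then show ?case by (simp add: continuous_on_add)
next
  case (Suc k)
  show ?case
    by (rule Ck_on_SucI[OF assms has_derivative_add[OF Ck_on_Suc_has_derivative[OF Suc.prems(1)]
          Ck_on_Suc_has_derivative[OF Suc.prems(2)]]])
      (use Suc.prems Suc.IH in simp_all)
qed

lemma Ck_on_sum:
  assumes "open S" "\<And>i. i \<in> I \<Longrightarrow> Ck_on k (f i) S"
  shows "Ck_on k (\<lambda>x. \<Sum>i\<in>I. f i x) S"
proof (cases "finite I")
  case True
  then show ?thesis using assms(2)
    by (induction I rule: finite_induct) (simp_all add: Ck_on_const Ck_on_add[OF assms(1)])
qed (simp add: Ck_on_const)

text \<open>The derivative of a product is a sum of two products of the same kind, so the induction
  closes once both factors are generalised.\<close>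

lemma (in bounded_bilinear) Ck_on_prod:
  assumes "open S"
  shows "Ck_on k f S \<Longrightarrow> Ck_on k h S \<Longrightarrow> Ck_on k (\<lambda>x. prod (f x) (h x)) S"
proof (induction k arbitrary: f h)
  case 0
  then show ?case by (simp add: continuous_on)
next
  case (Suc k)
  have "Ck_on k f S" "Ck_on k h S" using Suc.prems Ck_on_SucD by blast+
  then show ?case
    by (intro Ck_on_SucI[OF assms FDERIV[OF Ck_on_Suc_has_derivative[OF Suc.prems(1)]
          Ck_on_Suc_has_derivative[OF Suc.prems(2)]]] Ck_on_add[OF assms] Suc.IH)
      (use Suc.prems in simp_all)
qed

lemmas Ck_on_scaleR = bounded_bilinear.Ck_on_prod[OF bounded_bilinear_scaleR]
lemmas Ck_on_mult = bounded_bilinear.Ck_on_prod[OF bounded_bilinear_mult]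
lemmas Ck_on_inner = bounded_bilinear.Ck_on_prod[OF bounded_bilinear_inner]

lemma linear_sum_Basis:
  fixes L :: "'a::euclidean_space \<Rightarrow> 'b::real_vector"
  assumes "linear L"
  shows "(\<Sum>b\<in>Basis. (w \<bullet> b) *\<^sub>R L b) = L w"
proof -
  have "L w = L (\<Sum>b\<in>Basis. (w \<bullet> b) *\<^sub>R b)" by (simp only: euclidean_representation)
  also have "\<dots> = (\<Sum>b\<in>Basis. (w \<bullet> b) *\<^sub>R L b)"
    using assms by (simp only: linear_sum linear_cmul)
  finally show ?thesis by simp
qed

text \<open>The chain rule evaluates the derivative of \<open>g\<close> in a direction that moves
  with \<open>x\<close>, while \<open>Ck_on\<close> controls fixed directions only. Expanding the
  direction in the basis of the middle space separates the two dependencies.\<close>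

lemma Ck_on_compose:
  fixes f :: "'a::real_normed_vector \<Rightarrow> 'b::euclidean_space" and g :: "'b \<Rightarrow> 'c::real_normed_vector"
  assumes "open S" "open T" "f ` S \<subseteq> T"
  shows "Ck_on k f S \<Longrightarrow> Ck_on k g T \<Longrightarrow> Ck_on k (\<lambda>x. g (f x)) S"
proof (induction k arbitrary: g)
  case 0
  then show ?case using assms(3) by (auto intro: continuous_on_compose2)
next
  case (Suc k)
  let ?Df = "\<lambda>x. frechet_derivative f (at x)" and ?Dg = "\<lambda>y. frechet_derivative g (at y)"
  have der: "((\<lambda>x. g (f x)) has_derivative (\<lambda>v. \<Sum>b\<in>Basis. (?Df x v \<bullet> b) *\<^sub>R ?Dg (f x) b)) (at x)"
    if "x \<in> S" for x
  proof -
    have gd: "(g has_derivative ?Dg (f x)) (at (f x))"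
      using Suc.prems(2) assms(3) that by (intro Ck_on_Suc_has_derivative) auto
    have "linear (?Dg (f x))" using gd by (rule has_derivative_linear)
    then have "(\<Sum>b\<in>Basis. (w \<bullet> b) *\<^sub>R ?Dg (f x) b) = ?Dg (f x) w" for w
      by (rule linear_sum_Basis)
    then show ?thesis
      using has_derivative_compose[OF Ck_on_Suc_has_derivative[OF Suc.prems(1) that] gd] by simp
  qed
  have kf: "Ck_on k f S" using Suc.prems Ck_on_SucD by blast
  have "Ck_on k (\<lambda>x. (?Df x v \<bullet> b) *\<^sub>R ?Dg (f x) b) S" for v b
  proof (rule Ck_on_scaleR[OF assms(1)])
    show "Ck_on k (\<lambda>x. ?Df x v \<bullet> b) S"
      using Suc.prems(1) by (intro Ck_on_inner[OF assms(1)] Ck_on_const) simp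
    show "Ck_on k (\<lambda>x. ?Dg (f x) b) S"
      using Suc.prems(2) by (intro Suc.IH[OF kf]) simp
  qed
  then show ?case by (intro Ck_on_SucI[OF assms(1) der] Ck_on_sum[OF assms(1)])
qed

section \<open>Closure properties of smooth maps\<close>

lemma smooth_on_subset: "smooth_on f S \<Longrightarrow> T \<subseteq> S \<Longrightarrow> smooth_on f T"
  by (meson Ck_on_subset smooth_on_def)

lemma smooth_on_cong:
  "open S \<Longrightarrow> (\<And>x. x \<in> S \<Longrightarrow> f x = g x) \<Longrightarrow> smooth_on f S \<Longrightarrow> smooth_on g S"
  by (meson Ck_on_cong smooth_on_def)

lemma smooth_on_local:
  assumes "\<And>x. x \<in> S \<Longrightarrow> \<exists>T. open T \<and> x \<in> T \<and> smooth_on f T"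
  shows "smooth_on f S"
  using assms unfolding smooth_on_def by (meson Ck_on_local)

lemma smooth_on_const: "smooth_on (\<lambda>x. c) S"
  by (simp add: smooth_on_def Ck_on_const)

lemma smooth_on_bounded_linear: "open S \<Longrightarrow> bounded_linear f \<Longrightarrow> smooth_on f S"
  by (simp add: smooth_on_def Ck_on_bounded_linear)

lemma smooth_on_add: "open S \<Longrightarrow> smooth_on f S \<Longrightarrow> smooth_on g S \<Longrightarrow> smooth_on (\<lambda>x. f x + g x) S"
  by (simp add: smooth_on_def Ck_on_add)

lemma smooth_on_sum:
  "open S \<Longrightarrow> (\<And>i. i \<in> I \<Longrightarrow> smooth_on (f i) S) \<Longrightarrow> smooth_on (\<lambda>x. \<Sum>i\<in>I. f i x) S"
  by (simp add: smooth_on_def Ck_on_sum)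

lemma smooth_on_scaleR:
  "open S \<Longrightarrow> smooth_on f S \<Longrightarrow> smooth_on g S \<Longrightarrow> smooth_on (\<lambda>x. f x *\<^sub>R g x) S"
  by (simp add: smooth_on_def Ck_on_scaleR)

lemma smooth_on_inner:
  "open S \<Longrightarrow> smooth_on f S \<Longrightarrow> smooth_on g S \<Longrightarrow> smooth_on (\<lambda>x. f x \<bullet> g x) S"
  by (simp add: smooth_on_def Ck_on_inner)

lemma smooth_on_compose:
  fixes f :: "'a::real_normed_vector \<Rightarrow> 'b::euclidean_space" and g :: "'b \<Rightarrow> 'c::real_normed_vector"
  shows "open S \<Longrightarrow> open T \<Longrightarrow> f ` S \<subseteq> T \<Longrightarrow> smooth_on f S \<Longrightarrow> smooth_on g T
    \<Longrightarrow> smooth_on (\<lambda>x. g (f x)) S"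
  unfolding smooth_on_def using Ck_on_compose by blast

lemma smooth_on_deriv: "smooth_on f S \<Longrightarrow> smooth_on (\<lambda>x. frechet_derivative f (at x) v) S"
  unfolding smooth_on_def by (metis Ck_on.simps(2))

lemma smooth_on_has_derivative:
  "smooth_on f S \<Longrightarrow> x \<in> S \<Longrightarrow> (f has_derivative frechet_derivative f (at x)) (at x)"
  unfolding smooth_on_def using Ck_on_Suc_has_derivative by blast

lemma smooth_on_continuous: "smooth_on f S \<Longrightarrow> continuous_on S f"
  unfolding smooth_on_def by (metis Ck_on.simps(1))

text \<open>The moving direction is again expanded in the basis. This is what makes the derivative
  of a function along a vector field smooth.\<close>

lemma smooth_on_frechet_apply:
  fixes f :: "'a::euclidean_space \<Rightarrow> 'b::real_normed_vector"
  assumes "open S" "smooth_on f S" "smooth_on h S"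
  shows "smooth_on (\<lambda>x. frechet_derivative f (at x) (h x)) S"
proof -
  have *: "(\<Sum>b\<in>Basis. (h x \<bullet> b) *\<^sub>R frechet_derivative f (at x) b) = frechet_derivative f (at x) (h x)"
    if "x \<in> S" for x
  proof -
    have "linear (frechet_derivative f (at x))"
      using smooth_on_has_derivative[OF assms(2) that] by (rule has_derivative_linear)
    then show ?thesis by (rule linear_sum_Basis)
  qed
  show ?thesis
    by (rule smooth_on_cong[OF assms(1) *], assumption)
      (intro smooth_on_sum smooth_on_scaleR smooth_on_inner smooth_on_const smooth_on_deriv assms)
qed

section \<open>Flat functions and bump functions on Euclidean space\<close>

text \<open>The family is closed under differentiation up to linear combinations, which yields smoothness
  of \<open>exp (-1/t)\<close> by induction over the order.\<close>

definition flat_exp :: "nat \<Rightarrow> real \<Rightarrow> real" where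
  "flat_exp n t = (if 0 < t then inverse t ^ n / exp (inverse t) else 0)"

lemma flat_exp_tendsto_0: "(flat_exp n \<longlongrightarrow> 0) (at 0)"
proof (rule filterlim_split_at_real)
  have "((\<lambda>t::real. inverse t ^ n / exp (inverse t)) \<longlongrightarrow> 0) (at_right 0)"
    by (rule filterlim_compose[OF tendsto_power_div_exp_0 filterlim_inverse_at_top_right])
  then show "(flat_exp n \<longlongrightarrow> 0) (at_right 0)"
    by (rule Lim_transform_eventually) (auto simp: flat_exp_def eventually_at_filter)
  show "(flat_exp n \<longlongrightarrow> 0) (at_left 0)"
    by (rule Lim_transform_eventually[of "\<lambda>_. 0"]) (auto simp: flat_exp_def eventually_at_filter)
qed

lemma flat_exp_has_derivative:
  "(flat_exp n has_real_derivative (flat_exp (n + 2) t - real n * flat_exp (n + 1) t)) (at t)"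
proof (cases t "0::real" rule: linorder_cases)
  case less
  have "((\<lambda>_. 0) has_real_derivative 0) (at t)" by simp
  then have "(flat_exp n has_real_derivative 0) (at t)"
    by (rule has_field_derivative_transform_within_open[where S = "{..<0}"])
      (use less in \<open>auto simp: flat_exp_def\<close>)
  then show ?thesis using less by (simp add: flat_exp_def)
next
  case equal
  \<comment> \<open>The difference quotient at 0 is the next member of the family, whose limit there
    is known.\<close>
  have "flat_exp n h / h = flat_exp (Suc n) h" if "h \<noteq> 0" for h
    by (simp add: flat_exp_def field_simps)
  then have "((\<lambda>h. flat_exp n h / h) \<longlongrightarrow> 0) (at 0)"
    by (intro Lim_transform_eventually[OF flat_exp_tendsto_0[of "Suc n"]])
      (simp add: eventually_at_filter)
  then show ?thesis using equal by (simp add: DERIV_def flat_exp_def)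
next
  case greater
  have "((\<lambda>t. inverse t ^ n / exp (inverse t)) has_real_derivative
      (inverse t ^ (n + 2) / exp (inverse t) - real n * (inverse t ^ (n + 1) / exp (inverse t)))) (at t)"
  proof -
    define w where "w = inverse t"
    have 1: "((\<lambda>w. w ^ n / exp w) has_real_derivative (real n * w ^ (n - 1) - w ^ n) / exp w) (at (inverse t))"
      unfolding w_def by (auto intro!: derivative_eq_intros simp: field_simps power2_eq_square)
    have 2: "(inverse has_real_derivative - (w ^ 2)) (at t)"
      using greater DERIV_inverse[of t UNIV] by (simp add: w_def numeral_2_eq_2)
    have "(real n * w ^ (n - 1) - w ^ n) / exp w * - (w ^ 2)
        = w ^ (n + 2) / exp w - real n * (w ^ (n + 1) / exp w)"
      \<comment> \<open>For \<open>n = 0\<close> the exponent \<open>n - 1\<close> truncates, but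
        the factor \<open>n\<close> removes that term.\<close>
      by (cases n) (simp_all add: field_simps power2_eq_square)
    then show ?thesis using DERIV_chain2[OF 1 2] by (simp add: w_def)
  qed
  then have "(flat_exp n has_real_derivative
      (inverse t ^ (n + 2) / exp (inverse t) - real n * (inverse t ^ (n + 1) / exp (inverse t)))) (at t)"
    by (rule has_field_derivative_transform_within_open[where S = "{0<..}"])
      (use greater in \<open>auto simp: flat_exp_def\<close>)
  then show ?thesis using greater by (simp add: flat_exp_def)
qed

lemma Ck_on_flat_exp: "Ck_on k (flat_exp n) UNIV"
proof (induction k arbitrary: n)
  case 0
  have "isCont (flat_exp n) t" for t using flat_exp_has_derivative DERIV_isCont by blast
  then show ?case by (simp add: continuous_at_imp_continuous_on)
next
  case (Suc k)
  show ?case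
  proof (rule Ck_on_SucI)
    show "(flat_exp n has_derivative
        (\<lambda>v. flat_exp (n + 2) t * v + (- real n * v) * flat_exp (n + 1) t)) (at t)" for t
      using flat_exp_has_derivative[of n t] unfolding has_field_derivative_def
      by (rule has_derivative_eq_rhs) (auto simp: algebra_simps)
    show "Ck_on k (\<lambda>x. flat_exp (n + 2) x * v + - real n * v * flat_exp (n + 1) x) UNIV" for v
      by (intro Ck_on_add Ck_on_mult Suc.IH Ck_on_const open_UNIV)
  qed simp
qed

lemma smooth_bump:
  fixes a :: "'a::euclidean_space"
  assumes "r > 0"
  obtains b :: "'a \<Rightarrow> real" where "smooth_on b UNIV" "b a = 1" "\<And>u. u \<notin> cball a r \<Longrightarrow> b u = 0"
proof -
  \<comment> \<open>The argument of \<open>flat_exp\<close> in \<open>b\<close> is r^2 - |u - a|^2,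
    positive exactly on the open ball; it is spelled with sums, scalings and inner products to fit
    the closure rules. The constant \<open>c\<close> normalises the value at
    \<open>a\<close>.\<close>
  define c where "c = 1 / flat_exp 0 (r\<^sup>2)"
  define b where "b = (\<lambda>u. flat_exp 0 (r\<^sup>2 + (u + - a) \<bullet> (-1 *\<^sub>R (u + - a))) *\<^sub>R c)"
  have "smooth_on (flat_exp 0) UNIV" by (simp add: smooth_on_def Ck_on_flat_exp)
  then have flat: "smooth_on (\<lambda>u. flat_exp 0 (f u)) UNIV" if "smooth_on f UNIV" for f :: "'a \<Rightarrow> real"
    by (rule smooth_on_compose[OF open_UNIV open_UNIV subset_UNIV that])
  have lin: "smooth_on (\<lambda>u. u + - a) UNIV" for a :: 'a
    by (intro smooth_on_add smooth_on_const smooth_on_bounded_linear bounded_linear_ident open_UNIV)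
  have "smooth_on b UNIV" unfolding b_def
    by (rule smooth_on_scaleR[OF open_UNIV flat smooth_on_const],
        rule smooth_on_add[OF open_UNIV smooth_on_const],
        rule smooth_on_inner[OF open_UNIV lin],
        rule smooth_on_scaleR[OF open_UNIV smooth_on_const lin])
  moreover have "b a = 1" using assms by (simp add: b_def c_def flat_exp_def)
  moreover have "b u = 0" if "u \<notin> cball a r" for u
  proof -
    have "r < norm (u - a)" using that by (simp add: dist_norm norm_minus_commute)
    then have "r\<^sup>2 < (norm (u - a))\<^sup>2" using assms by (intro power_strict_mono) auto
    moreover have "(u + - a) \<bullet> (-1 *\<^sub>R (u + - a)) = - (norm (u - a))\<^sup>2"
      by (simp add: power2_norm_eq_inner inner_diff_right inner_diff_left)
    ultimately show ?thesis unfolding b_def flat_exp_def by simp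
  qed
  ultimately show ?thesis using that by blast
qed

section \<open>Symmetry of second derivatives\<close>

lemma has_real_derivative_along_line:
  fixes f :: "'a::real_normed_vector \<Rightarrow> real"
  assumes "smooth_on f S" "w + s *\<^sub>R a \<in> S"
  shows "((\<lambda>s. f (w + s *\<^sub>R a)) has_real_derivative frechet_derivative f (at (w + s *\<^sub>R a)) a) (at s)"
proof -
  define L where "L = frechet_derivative f (at (w + s *\<^sub>R a))"
  have d: "(f has_derivative L) (at (w + s *\<^sub>R a))"
    using smooth_on_has_derivative[OF assms] by (simp add: L_def)
  have "((\<lambda>s. w + s *\<^sub>R a) has_derivative (\<lambda>h. h *\<^sub>R a)) (at s)"
    by (auto intro!: derivative_eq_intros)
  then have "((\<lambda>s. f (w + s *\<^sub>R a)) has_derivative (\<lambda>h. L (h *\<^sub>R a))) (at s)"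
    using d by (rule has_derivative_compose[of "\<lambda>s. w + s *\<^sub>R a" "\<lambda>h. h *\<^sub>R a" s UNIV f L])
  moreover have "L (h *\<^sub>R a) = L a * h" for h
    using has_derivative_linear[OF d] by (simp add: linear_cmul)
  ultimately show ?thesis by (simp add: has_field_derivative_def L_def)
qed

text \<open>The mean value theorem is used twice, along \<open>a\<close> and then along
  \<open>b\<close>. The point is that the second difference is symmetric in \<open>a\<close> and
  \<open>b\<close>.\<close>

lemma second_difference_mvt:
  fixes f :: "'a::euclidean_space \<Rightarrow> real"
  assumes "smooth_on f (ball u r)" "t > 0" "t * (norm a + norm b) < r"
  obtains z where "z \<in> ball u r" "dist z u \<le> t * (norm a + norm b)"
    "f (u + t *\<^sub>R a + t *\<^sub>R b) - f (u + t *\<^sub>R a) - f (u + t *\<^sub>R b) + f u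
      = t * (t * frechet_derivative (\<lambda>z. frechet_derivative f (at z) a) (at z) b)"
proof -
  let ?D = "\<lambda>z. frechet_derivative f (at z) a"
  have ball: "u + s *\<^sub>R a + q *\<^sub>R b \<in> ball u r \<and> dist (u + s *\<^sub>R a + q *\<^sub>R b) u \<le> t * (norm a + norm b)"
    if "0 \<le> s" "s \<le> t" "0 \<le> q" "q \<le> t" for s q
  proof -
    have "norm (s *\<^sub>R a + q *\<^sub>R b) \<le> s * norm a + q * norm b"
      using that norm_triangle_ineq[of "s *\<^sub>R a" "q *\<^sub>R b"] by simp
    also have "\<dots> \<le> t * norm a + t * norm b"
      using that by (intro add_mono mult_right_mono) auto
    finally have "norm (s *\<^sub>R a + q *\<^sub>R b) \<le> t * (norm a + norm b)" by (simp add: distrib_left)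
    moreover have "dist (u + s *\<^sub>R a + q *\<^sub>R b) u = norm (s *\<^sub>R a + q *\<^sub>R b)"
      by (simp add: dist_norm add.assoc)
    ultimately show ?thesis using assms(3) by (simp add: dist_commute[of u])
  qed
  have ball0: "u + s *\<^sub>R a \<in> ball u r" if "0 \<le> s" "s \<le> t" for s
    using ball[OF that, of 0] assms(2) by simp
  have D: "smooth_on ?D (ball u r)" by (rule smooth_on_deriv[OF assms(1)])
  define G where "G = (\<lambda>s. f (u + t *\<^sub>R b + s *\<^sub>R a) - f (u + s *\<^sub>R a))"
  have "\<exists>s>0. s < t \<and> G t - G 0 = (t - 0) * (?D (u + t *\<^sub>R b + s *\<^sub>R a) - ?D (u + s *\<^sub>R a))"
  proof (rule MVT2[OF assms(2)])
    fix s assume "0 \<le> s" "s \<le> t"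
    then show "(G has_real_derivative ?D (u + t *\<^sub>R b + s *\<^sub>R a) - ?D (u + s *\<^sub>R a)) (at s)"
      unfolding G_def using ball[of s t] ball0[of s] assms(2)
      by (intro DERIV_diff has_real_derivative_along_line[OF assms(1)]) (auto simp: algebra_simps)
  qed
  \<comment> \<open>The summand \<open>0 *\<^sub>R b\<close> gives the lower end point the form from
    which the second application, along \<open>b\<close>, starts.\<close>
  then obtain s where s: "0 < s" "s < t"
    "G t - G 0 = t * (?D (u + s *\<^sub>R a + t *\<^sub>R b) - ?D (u + s *\<^sub>R a + 0 *\<^sub>R b))"
    by (auto simp: add_ac)
  have "\<exists>q>0. q < t \<and> ?D (u + s *\<^sub>R a + t *\<^sub>R b) - ?D (u + s *\<^sub>R a + 0 *\<^sub>R b)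
      = (t - 0) * frechet_derivative ?D (at (u + s *\<^sub>R a + q *\<^sub>R b)) b"
    by (rule MVT2[OF assms(2)], rule has_real_derivative_along_line[OF D]) (use ball[of s] s in auto)
  then obtain q where q: "0 < q" "q < t" "?D (u + s *\<^sub>R a + t *\<^sub>R b) - ?D (u + s *\<^sub>R a + 0 *\<^sub>R b)
      = t * frechet_derivative ?D (at (u + s *\<^sub>R a + q *\<^sub>R b)) b" by auto
  show ?thesis
    using that[of "u + s *\<^sub>R a + q *\<^sub>R b"] ball[of s q] s(1,2) q(1,2) s(3)[unfolded q(3)]
    by (simp add: G_def algebra_simps)
qed

text \<open>One and the same second difference yields equal values of the two mixed derivatives at
  points \<open>z1\<close> and \<open>z2\<close> close to \<open>u\<close>; continuity carries the
  equality to \<open>u\<close> up to any \<open>e\<close>.\<close>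

lemma second_derivative_symmetric:
  fixes f :: "'a::euclidean_space \<Rightarrow> real"
  assumes "open S" "u \<in> S" "smooth_on f S"
  shows "frechet_derivative (\<lambda>z. frechet_derivative f (at z) a) (at u) b
    = frechet_derivative (\<lambda>z. frechet_derivative f (at z) b) (at u) a"
proof -
  let ?Q = "\<lambda>a b z. frechet_derivative (\<lambda>z. frechet_derivative f (at z) a) (at z) b"
  have "\<bar>?Q a b u - ?Q b a u\<bar> \<le> e" if "e > 0" for e
  proof -
    have cont: "isCont (?Q a b) u" for a b
      using smooth_on_continuous[OF smooth_on_deriv[OF smooth_on_deriv[OF assms(3)]]] assms(1,2)
      by (simp add: continuous_on_eq_continuous_at)
    have near: "\<exists>d>0. \<forall>z. dist z u < d \<longrightarrow> dist (?Q a b z) (?Q a b u) < e / 2" for a b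
      using cont[of a b] \<open>e > 0\<close> unfolding continuous_at_eps_delta by (metis half_gt_zero)
    obtain d1 where d1: "d1 > 0" "\<And>z. dist z u < d1 \<Longrightarrow> dist (?Q a b z) (?Q a b u) < e / 2"
      using near by blast
    obtain d2 where d2: "d2 > 0" "\<And>z. dist z u < d2 \<Longrightarrow> dist (?Q b a z) (?Q b a u) < e / 2"
      using near by blast
    obtain r where r: "r > 0" "ball u r \<subseteq> S" using assms openE by blast
    define m where "m = min r (min d1 d2)"
    \<comment> \<open>The summand 1 keeps the denominator positive if \<open>a\<close> and
      \<open>b\<close> vanish; the factor 2 bounds the displacement by \<open>m / 2\<close>.\<close>
    define t where "t = m / (2 * (norm a + norm b + 1))"
    have m: "m > 0" using r d1 d2 by (simp add: m_def)
    have n: "norm a + norm b + 1 > 0" using norm_ge_zero[of a] norm_ge_zero[of b] by linarith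
    have t: "t > 0" using m n by (simp add: t_def)
    have "t * (norm a + norm b) \<le> t * (norm a + norm b + 1)" using t by simp
    also have "\<dots> = m / 2" using n unfolding t_def by (simp add: field_simps)
    finally have tm: "t * (norm a + norm b) < m" using m by simp
    have sm: "smooth_on f (ball u r)" using assms r smooth_on_subset by blast
    obtain z1 where z1: "dist z1 u \<le> t * (norm a + norm b)"
      "f (u + t *\<^sub>R a + t *\<^sub>R b) - f (u + t *\<^sub>R a) - f (u + t *\<^sub>R b) + f u = t * (t * ?Q a b z1)"
      using second_difference_mvt[OF sm t, of a b] tm m_def by auto
    obtain z2 where z2: "dist z2 u \<le> t * (norm b + norm a)"
      "f (u + t *\<^sub>R b + t *\<^sub>R a) - f (u + t *\<^sub>R b) - f (u + t *\<^sub>R a) + f u = t * (t * ?Q b a z2)"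
      using second_difference_mvt[OF sm t, of b a] tm m_def by (auto simp: add.commute)
    have "t * (t * ?Q a b z1) = t * (t * ?Q b a z2)"
      using z1(2) z2(2) by (simp add: algebra_simps)
    then have "?Q a b z1 = ?Q b a z2" using t by simp
    moreover have "dist (?Q a b z1) (?Q a b u) < e / 2" "dist (?Q b a z2) (?Q b a u) < e / 2"
      using d1(2)[of z1] d2(2)[of z2] z1(1) z2(1) tm by (auto simp: m_def add.commute)
    ultimately show ?thesis unfolding dist_real_def by linarith
  qed
  then have "\<bar>?Q a b u - ?Q b a u\<bar> \<le> 0 + e" if "e > 0" for e using that by simp
  then have "\<bar>?Q a b u - ?Q b a u\<bar> \<le> 0" by (rule field_le_epsilon)
  then show ?thesis by simp
qed

text \<open>Product rule for evaluating the derivative of \<open>f\<close> in the moving direction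
  \<open>h\<close>. The second-order part is the one that cancels in a Lie bracket.\<close>

lemma frechet_derivative_apply_deriv:
  fixes f :: "'a::euclidean_space \<Rightarrow> real"
  assumes "open S" "u \<in> S" "smooth_on f S" "smooth_on h S"
  shows "((\<lambda>z. frechet_derivative f (at z) (h z)) has_derivative
    (\<lambda>a. frechet_derivative (\<lambda>z. frechet_derivative f (at z) (h u)) (at u) a
       + frechet_derivative f (at u) (frechet_derivative h (at u) a))) (at u)"
proof -
  let ?D = "\<lambda>b z. frechet_derivative f (at z) b"
  have lin: "linear (frechet_derivative f (at z))" if "z \<in> S" for z
    using smooth_on_has_derivative[OF assms(3) that] by (rule has_derivative_linear)
  have dD: "(?D b has_derivative frechet_derivative (?D b) (at u)) (at u)" for b
    by (rule smooth_on_has_derivative[OF smooth_on_deriv[OF assms(3)] assms(2)])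
  have dh: "(h has_derivative frechet_derivative h (at u)) (at u)"
    by (rule smooth_on_has_derivative[OF assms(4,2)])
  have 1: "((\<lambda>z. \<Sum>b\<in>Basis. (h z \<bullet> b) *\<^sub>R ?D b z) has_derivative
      (\<lambda>a. \<Sum>b\<in>Basis. (h u \<bullet> b) *\<^sub>R frechet_derivative (?D b) (at u) a
        + (frechet_derivative h (at u) a \<bullet> b) *\<^sub>R ?D b u)) (at u)"
    by (intro has_derivative_sum has_derivative_scaleR has_derivative_inner_left dD dh)
  have 2: "((\<lambda>z. \<Sum>b\<in>Basis. (h u \<bullet> b) *\<^sub>R ?D b z) has_derivative
      (\<lambda>a. \<Sum>b\<in>Basis. (h u \<bullet> b) *\<^sub>R frechet_derivative (?D b) (at u) a)) (at u)"
    by (intro has_derivative_sum has_derivative_scaleR_right dD)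
  have "(?D (h u) has_derivative
      (\<lambda>a. \<Sum>b\<in>Basis. (h u \<bullet> b) *\<^sub>R frechet_derivative (?D b) (at u) a)) (at u)"
    by (rule has_derivative_transform_within_open[OF 2 assms(1,2)])
      (simp only: linear_sum_Basis[OF lin])
  \<comment> \<open>With the direction frozen at \<open>h u\<close>, the first half of the basis sum
    becomes recognisable as a second derivative.\<close>
  then have 3: "frechet_derivative (?D (h u)) (at u)
      = (\<lambda>a. \<Sum>b\<in>Basis. (h u \<bullet> b) *\<^sub>R frechet_derivative (?D b) (at u) a)"
    by (rule frechet_derivative_at[symmetric])
  have "((\<lambda>z. ?D (h z) z) has_derivative
      (\<lambda>a. \<Sum>b\<in>Basis. (h u \<bullet> b) *\<^sub>R frechet_derivative (?D b) (at u) a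
        + (frechet_derivative h (at u) a \<bullet> b) *\<^sub>R ?D b u)) (at u)"
    by (rule has_derivative_transform_within_open[OF 1 assms(1,2)])
      (simp only: linear_sum_Basis[OF lin])
  then show ?thesis
    by (simp only: 3 sum.distrib linear_sum_Basis[OF lin[OF assms(2)]])
qed

section \<open>Smooth functions and vector fields on a manifold\<close>

locale smooth_manifold =
  fixes A :: "('m::{t2_space, second_countable_topology}, 'n::finite) chart set"
  assumes atlas: "smooth_atlas A"
begin

lemma chart_homeo: "(U, x) \<in> A \<Longrightarrow> homeomorphism U (x ` U) x (inv_into U x)"
  and chart_open: "(U, x) \<in> A \<Longrightarrow> open U"
  and chart_open_image: "(U, x) \<in> A \<Longrightarrow> open (x ` U)"
  using atlas by (force simp: smooth_atlas_def is_chart_def)+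

lemma chart_inv: "(U, x) \<in> A \<Longrightarrow> q \<in> U \<Longrightarrow> inv_into U x (x q) = q"
  using chart_homeo by (metis homeomorphism_apply1)

lemma chart_inv_image:
  assumes "(U, x) \<in> A" "u \<in> x ` (U \<inter> W)"
  shows "inv_into U x u \<in> U" "inv_into U x u \<in> W" "x (inv_into U x u) = u"
  using assms chart_inv by auto

lemma open_chart_image:
  assumes "(U, x) \<in> A" "open W" shows "open (x ` (U \<inter> W))"
proof -
  have "continuous_on (x ` U) (inv_into U x)"
    using chart_homeo[OF assms(1)] by (auto simp: homeomorphism_def)
  then have "open (x ` U \<inter> inv_into U x -` W)"
    using continuous_open_preimage chart_open_image[OF assms(1)] assms(2) by blast
  moreover have "x ` (U \<inter> W) = x ` U \<inter> inv_into U x -` W"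
    using chart_inv[OF assms(1)] by force
  ultimately show ?thesis by simp
qed

lemma transition_smooth:
  "(U, x) \<in> A \<Longrightarrow> (V, y) \<in> A \<Longrightarrow> smooth_on (y \<circ> inv_into U x) (x ` (U \<inter> V))"
  using atlas by (force simp: smooth_atlas_def)

lemma chart_smooth: "(V, y) \<in> A \<Longrightarrow> smooth_map_on A V y"
  using transition_smooth by (auto simp: smooth_map_on_def)

lemma chart_at_props: "chart_at A p \<in> A" "p \<in> fst (chart_at A p)"
proof -
  have "p \<in> (\<Union>c\<in>A. fst c)" using atlas unfolding smooth_atlas_def by blast
  then have "\<exists>c. c \<in> A \<and> p \<in> fst c" by blast
  then show "chart_at A p \<in> A" "p \<in> fst (chart_at A p)"
    unfolding chart_at_def by (metis (mono_tags, lifting) someI_ex)+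
qed

lemma chart_at_cases:
  obtains U x where "chart_at A p = (U, x)" "(U, x) \<in> A" "p \<in> U"
  using chart_at_props[of p] by (cases "chart_at A p") auto

lemma smooth_map_onD:
  "smooth_map_on A W f \<Longrightarrow> (U, x) \<in> A \<Longrightarrow> smooth_on (f \<circ> inv_into U x) (x ` (U \<inter> W))"
  by (auto simp: smooth_map_on_def)

text \<open>One chart around each point is enough, because smooth transition maps carry smoothness
  to every other chart.\<close>

lemma smooth_map_onI:
  assumes "\<And>q. q \<in> W \<Longrightarrow> \<exists>U x N. (U, x) \<in> A \<and> open N \<and> q \<in> N \<and> q \<in> U \<and>
      smooth_on (f \<circ> inv_into U x) (x ` (U \<inter> N))"
  shows "smooth_map_on A W f"
  unfolding smooth_map_on_def
proof safe
  fix V y assume V: "(V, y) \<in> A"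
  show "smooth_on (f \<circ> inv_into V y) (y ` (V \<inter> W))"
  proof (rule smooth_on_local)
    fix u assume "u \<in> y ` (V \<inter> W)"
    then obtain q where q: "q \<in> V" "q \<in> W" "u = y q" by auto
    obtain U x N where N: "(U, x) \<in> A" "open N" "q \<in> N" "q \<in> U"
      "smooth_on (f \<circ> inv_into U x) (x ` (U \<inter> N))" using assms[OF q(2)] by auto
    let ?T = "y ` (V \<inter> (U \<inter> N))"
    have UN: "open (U \<inter> N)" using N chart_open by auto
    have T: "open ?T" by (rule open_chart_image[OF V UN])
    have tr: "smooth_on (x \<circ> inv_into V y) ?T"
      using transition_smooth[OF V N(1)] by (rule smooth_on_subset) auto
    have sm: "smooth_on (\<lambda>u. (f \<circ> inv_into U x) ((x \<circ> inv_into V y) u)) ?T"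
      by (rule smooth_on_compose[OF T open_chart_image[OF N(1,2)] _ tr N(5)])
        (use chart_inv_image[OF V] in force)
    have eq: "(f \<circ> inv_into U x) ((x \<circ> inv_into V y) u) = (f \<circ> inv_into V y) u" if "u \<in> ?T" for u
      using chart_inv_image(2)[OF V that] chart_inv[OF N(1)] by simp
    have "smooth_on (f \<circ> inv_into V y) ?T" by (rule smooth_on_cong[OF T eq sm])
    then show "\<exists>T. open T \<and> u \<in> T \<and> smooth_on (f \<circ> inv_into V y) T" using T q N by blast
  qed
qed

lemma smooth_map_on_subset: "smooth_map_on A W f \<Longrightarrow> W' \<subseteq> W \<Longrightarrow> smooth_map_on A W' f"
  unfolding smooth_map_on_def by (fastforce intro: smooth_on_subset)

lemma smooth_map_on_local:
  assumes "\<And>q. q \<in> W \<Longrightarrow> \<exists>N. open N \<and> q \<in> N \<and> smooth_map_on A N f"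
  shows "smooth_map_on A W f"
proof (rule smooth_map_onI)
  fix q assume "q \<in> W"
  then obtain N where "open N" "q \<in> N" "smooth_map_on A N f" using assms by blast
  then show "\<exists>U x N. (U, x) \<in> A \<and> open N \<and> q \<in> N \<and> q \<in> U \<and>
      smooth_on (f \<circ> inv_into U x) (x ` (U \<inter> N))"
    using chart_at_cases[of q] smooth_map_onD by metis
qed

lemma smooth_map_on_cong:
  assumes "open W" "\<And>q. q \<in> W \<Longrightarrow> f q = g q" "smooth_map_on A W f"
  shows "smooth_map_on A W g"
  unfolding smooth_map_on_def
proof safe
  fix U x assume U: "(U, x) \<in> A"
  show "smooth_on (g \<circ> inv_into U x) (x ` (U \<inter> W))"
    by (rule smooth_on_cong[OF open_chart_image[OF U assms(1)] _ smooth_map_onD[OF assms(3) U]])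
      (use chart_inv_image(2)[OF U] assms(2) in force)
qed

lemma smooth_map_on_const: "smooth_map_on A W (\<lambda>q. c)"
  by (auto simp: smooth_map_on_def o_def smooth_on_const)

lemma smooth_map_on_add:
  "open W \<Longrightarrow> smooth_map_on A W f \<Longrightarrow> smooth_map_on A W g \<Longrightarrow> smooth_map_on A W (\<lambda>q. f q + g q)"
  unfolding smooth_map_on_def using open_chart_image
  by (fastforce simp: o_def intro!: smooth_on_add)

lemma smooth_map_on_scaleR:
  "open W \<Longrightarrow> smooth_map_on A W f \<Longrightarrow> smooth_map_on A W g \<Longrightarrow> smooth_map_on A W (\<lambda>q. f q *\<^sub>R g q)"
  unfolding smooth_map_on_def using open_chart_image
  by (fastforce simp: o_def intro!: smooth_on_scaleR)

lemma smooth_map_on_bounded_linear: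
  fixes f :: "'m \<Rightarrow> 'b::euclidean_space"
  assumes "open W" "smooth_map_on A W f" "bounded_linear L"
  shows "smooth_map_on A W (\<lambda>q. L (f q))"
  unfolding smooth_map_on_def
proof safe
  fix U x assume U: "(U, x) \<in> A"
  have "smooth_on (\<lambda>u. L ((f \<circ> inv_into U x) u)) (x ` (U \<inter> W))"
    by (rule smooth_on_compose[OF open_chart_image[OF U assms(1)] open_UNIV subset_UNIV
          smooth_map_onD[OF assms(2) U] smooth_on_bounded_linear[OF open_UNIV assms(3)]])
  then show "smooth_on ((\<lambda>q. L (f q)) \<circ> inv_into U x) (x ` (U \<inter> W))" by (simp add: o_def)
qed

lemma smooth_fun_const: "smooth_fun A (\<lambda>q. c)"
  by (simp add: smooth_fun_def smooth_map_on_const)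

lemma smooth_fun_add: "smooth_fun A f \<Longrightarrow> smooth_fun A g \<Longrightarrow> smooth_fun A (\<lambda>q. f q + g q)"
  by (simp add: smooth_fun_def smooth_map_on_add)

lemma smooth_fun_mult: "smooth_fun A f \<Longrightarrow> smooth_fun A g \<Longrightarrow> smooth_fun A (\<lambda>q. f q * g q)"
  using smooth_map_on_scaleR[of UNIV f g] by (simp add: smooth_fun_def)

lemma smooth_fun_minus: "smooth_fun A f \<Longrightarrow> smooth_fun A (\<lambda>q. - f q)"
  using smooth_fun_mult[OF smooth_fun_const[of "-1"]] by simp

lemma smooth_fun_diff: "smooth_fun A f \<Longrightarrow> smooth_fun A g \<Longrightarrow> smooth_fun A (\<lambda>q. f q - g q)"
  using smooth_fun_add[OF _ smooth_fun_minus] by simp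

subsection \<open>The differential\<close>

lemma smooth_map_on_has_derivative:
  assumes "smooth_map_on A W f" "(U, x) \<in> A" "q \<in> U" "q \<in> W"
  shows "(f \<circ> inv_into U x has_derivative frechet_derivative (f \<circ> inv_into U x) (at (x q))) (at (x q))"
  using smooth_on_has_derivative[OF smooth_map_onD[OF assms(1,2)]] assms(3,4) by blast

lemma dif_eqI:
  "chart_at A q = (U, x) \<Longrightarrow> (f \<circ> inv_into U x has_derivative D) (at (x q)) \<Longrightarrow> dif A f q = D"
  by (auto simp: dif_def fun_eq_iff dest: frechet_derivative_at)

lemma dif_has_derivative:
  assumes "smooth_map_on A W f" "q \<in> W" "chart_at A q = (U, x)"
  shows "(f \<circ> inv_into U x has_derivative dif A f q) (at (x q))"
proof -
  have "(U, x) \<in> A" "q \<in> U" using chart_at_props[of q] assms(3) by auto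
  from smooth_map_on_has_derivative[OF assms(1) this assms(2)]
  show ?thesis using dif_eqI[OF assms(3)] by metis
qed

lemma dif_linear: "smooth_map_on A W f \<Longrightarrow> q \<in> W \<Longrightarrow> linear (dif A f q)"
  by (metis chart_at_cases dif_has_derivative has_derivative_linear)

lemma has_derivative_change_chart:
  fixes f :: "'m \<Rightarrow> 'b::real_normed_vector"
  assumes U: "(U, x) \<in> A" and V: "(V, y) \<in> A" and q: "q \<in> U" "q \<in> V"
    and D: "(f \<circ> inv_into U x has_derivative D) (at (x q))"
  shows "(f \<circ> inv_into V y has_derivative
    (\<lambda>v. D (frechet_derivative (x \<circ> inv_into V y) (at (y q)) v))) (at (y q))"
proof -
  have 1: "(x \<circ> inv_into V y has_derivative frechet_derivative (x \<circ> inv_into V y) (at (y q))) (at (y q))"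
    by (rule smooth_map_on_has_derivative[OF chart_smooth[OF U] V q(2,1)])
  have eq: "(x \<circ> inv_into V y) (y q) = x q" using chart_inv[OF V q(2)] by simp
  have 2: "((\<lambda>u. (f \<circ> inv_into U x) ((x \<circ> inv_into V y) u)) has_derivative
      (\<lambda>v. D (frechet_derivative (x \<circ> inv_into V y) (at (y q)) v))) (at (y q))"
    by (rule has_derivative_compose[OF 1]) (use D in \<open>simp only: eq\<close>)
  show ?thesis
    by (rule has_derivative_transform_within_open[OF 2 open_chart_image[OF V chart_open[OF U]]])
      (use q chart_inv[OF U] chart_inv_image[OF V] in auto)
qed

text \<open>Frees \<open>dif\<close> from the chosen chart \<open>chart_at A q\<close>: any chart
  around \<open>q\<close> computes it.\<close>

lemma dif_chart:
  fixes f :: "'m \<Rightarrow> 'b::real_normed_vector"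
  assumes "smooth_map_on A W f" "(U, x) \<in> A" "q \<in> U" "q \<in> W"
  shows "dif A f q v = frechet_derivative (f \<circ> inv_into U x) (at (x q)) (dif A x q v)"
proof -
  obtain V y where V: "chart_at A q = (V, y)" "(V, y) \<in> A" "q \<in> V" by (rule chart_at_cases)
  have "dif A f q = (\<lambda>v. frechet_derivative (f \<circ> inv_into U x) (at (x q))
      (frechet_derivative (x \<circ> inv_into V y) (at (y q)) v))"
    by (rule dif_eqI[OF V(1) has_derivative_change_chart[OF assms(2) V(2) assms(3) V(3)
          smooth_map_on_has_derivative[OF assms]]])
  then show ?thesis using V(1) by (simp add: dif_def)
qed

lemma dif_const: "dif A (\<lambda>q. c) p v = 0"
  by (cases "chart_at A p") (simp add: dif_def o_def)

lemma dif_add: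
  assumes "smooth_map_on A W f" "smooth_map_on A W g" "q \<in> W"
  shows "dif A (\<lambda>r. f r + g r) q v = dif A f q v + dif A g q v"
proof -
  obtain U x where U: "chart_at A q = (U, x)" "(U, x) \<in> A" "q \<in> U" by (rule chart_at_cases)
  have "dif A (\<lambda>r. f r + g r) q = (\<lambda>v. dif A f q v + dif A g q v)"
    using has_derivative_add[OF dif_has_derivative[OF assms(1,3) U(1)] dif_has_derivative[OF assms(2,3) U(1)]]
    by (intro dif_eqI[OF U(1)]) (simp add: o_def)
  then show ?thesis by simp
qed

lemma dif_mult:
  fixes f g :: "'m \<Rightarrow> real"
  assumes "smooth_map_on A W f" "smooth_map_on A W g" "q \<in> W"
  shows "dif A (\<lambda>r. f r * g r) q v = f q * dif A g q v + dif A f q v * g q"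
proof -
  obtain U x where U: "chart_at A q = (U, x)" "(U, x) \<in> A" "q \<in> U" by (rule chart_at_cases)
  have "dif A (\<lambda>r. f r * g r) q = (\<lambda>v. f q * dif A g q v + dif A f q v * g q)"
    using has_derivative_mult[OF dif_has_derivative[OF assms(1,3) U(1)] dif_has_derivative[OF assms(2,3) U(1)]]
    by (intro dif_eqI[OF U(1)]) (simp add: o_def chart_inv[OF U(2,3)])
  then show ?thesis by simp
qed

text \<open>Nothing is assumed about the differentiability of \<open>r\<close>; it follows from r =
  f / h on the open set where \<open>h\<close> is nonzero. This is how the Ricci tensor is
  differentiated later.\<close>

lemma dif_quotient:
  fixes f h r :: "'m \<Rightarrow> real"
  assumes f: "smooth_map_on A W f" and h: "smooth_map_on A W h" and W: "open W" "q \<in> W"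
    and "h q \<noteq> 0" and eq: "\<And>s. s \<in> W \<Longrightarrow> h s \<noteq> 0 \<Longrightarrow> h s * r s = f s"
  shows "dif A f q v = h q * dif A r q v + dif A h q v * r q"
proof -
  obtain U x where U: "chart_at A q = (U, x)" "(U, x) \<in> A" "q \<in> U" by (rule chart_at_cases)
  note df = dif_has_derivative[OF f W(2) U(1)] and dh = dif_has_derivative[OF h W(2) U(1)]
  have q: "(h \<circ> inv_into U x) (x q) \<noteq> 0" using assms(5) chart_inv[OF U(2,3)] by simp
  have W': "open (x ` (U \<inter> W))" "x q \<in> x ` (U \<inter> W)" using open_chart_image[OF U(2) W(1)] U W by auto
  define S where "S = {u \<in> x ` (U \<inter> W). (h \<circ> inv_into U x) u \<noteq> 0}"
  have "open (x ` (U \<inter> W) \<inter> (h \<circ> inv_into U x) -` (- {0}))"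
    by (rule continuous_open_preimage[OF smooth_on_continuous[OF smooth_map_onD[OF h U(2)]] W'(1)]) auto
  then have S: "open S" "x q \<in> S" using q W' unfolding S_def by (auto simp: vimage_def Int_def)
  obtain D where "((\<lambda>u. (f \<circ> inv_into U x) u / (h \<circ> inv_into U x) u) has_derivative D) (at (x q))"
    using has_derivative_divide'[OF df dh q] by blast
  then have "(r \<circ> inv_into U x has_derivative D) (at (x q))"
    by (rule has_derivative_transform_within_open[OF _ S])
      (use eq chart_inv_image(2)[OF U(2)] in \<open>auto simp: S_def divide_simps mult.commute\<close>)
  then have dr: "(r \<circ> inv_into U x has_derivative dif A r q) (at (x q))"
    using dif_eqI[OF U(1)] by metis
  have "((\<lambda>u. (h \<circ> inv_into U x) u * (r \<circ> inv_into U x) u) has_derivative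
      (\<lambda>v. h q * dif A r q v + dif A h q v * r q)) (at (x q))"
    using has_derivative_mult[OF dh dr] by (simp add: chart_inv[OF U(2,3)])
  then have "(f \<circ> inv_into U x has_derivative
      (\<lambda>v. h q * dif A r q v + dif A h q v * r q)) (at (x q))"
    by (rule has_derivative_transform_within_open[OF _ S])
      (use eq chart_inv_image(2)[OF U(2)] in \<open>auto simp: S_def\<close>)
  then show ?thesis using dif_eqI[OF U(1)] by metis
qed

lemma dif_chart_at:
  assumes "chart_at A q = (U, x)" shows "dif A x q v = v"
proof -
  have U: "(U, x) \<in> A" "q \<in> U" using chart_at_props[of q] assms by auto
  have "(x \<circ> inv_into U x has_derivative (\<lambda>v. v)) (at (x q))"
    by (rule has_derivative_transform_within_open[OF has_derivative_ident chart_open_image[OF U(1)]])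
      (use U chart_inv_image[OF U(1), of _ U] in auto)
  then show ?thesis using dif_eqI[OF assms] by metis
qed

subsection \<open>Vector fields\<close>

lemma smooth_vfD: "smooth_vf A X \<Longrightarrow> (V, y) \<in> A \<Longrightarrow> smooth_map_on A V (\<lambda>p. dif A y p (X p))"
  by (auto simp: smooth_vf_def)

lemma dif_chart_linear: "(V, y) \<in> A \<Longrightarrow> q \<in> V \<Longrightarrow> linear (dif A y q)"
  using chart_smooth dif_linear by blast

lemma smooth_vf_add:
  assumes "smooth_vf A X" "smooth_vf A Y" shows "smooth_vf A (\<lambda>p. X p + Y p)"
  unfolding smooth_vf_def
proof safe
  fix V y assume V: "(V, y) \<in> A"
  show "smooth_map_on A V (\<lambda>p. dif A y p (X p + Y p))"
    by (rule smooth_map_on_cong[OF chart_open[OF V] _ smooth_map_on_add[OF chart_open[OF V]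
        smooth_vfD[OF assms(1) V] smooth_vfD[OF assms(2) V]]])
      (simp add: linear_add[OF dif_chart_linear[OF V]])
qed

lemma smooth_vf_scaleR:
  assumes "smooth_fun A f" "smooth_vf A X" shows "smooth_vf A (\<lambda>p. f p *\<^sub>R X p)"
  unfolding smooth_vf_def
proof safe
  fix V y assume V: "(V, y) \<in> A"
  have f: "smooth_map_on A V f" using assms(1) unfolding smooth_fun_def by (rule smooth_map_on_subset) simp
  show "smooth_map_on A V (\<lambda>p. dif A y p (f p *\<^sub>R X p))"
    by (rule smooth_map_on_cong[OF chart_open[OF V] _ smooth_map_on_scaleR[OF chart_open[OF V]
        f smooth_vfD[OF assms(2) V]]])
      (simp add: linear_cmul[OF dif_chart_linear[OF V]])
qed

lemma smooth_vf_minus: "smooth_vf A X \<Longrightarrow> smooth_vf A (\<lambda>p. - X p)"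
  using smooth_vf_scaleR[OF smooth_fun_const[of "-1"]] by simp

lemma smooth_vf_diff: "smooth_vf A X \<Longrightarrow> smooth_vf A Y \<Longrightarrow> smooth_vf A (\<lambda>p. X p - Y p)"
  using smooth_vf_add[OF _ smooth_vf_minus] by simp

lemma vf_apply_smooth:
  assumes "smooth_vf A X" "smooth_fun A f" shows "smooth_fun A (vf_apply A X f)"
  unfolding smooth_fun_def
proof (rule smooth_map_onI)
  fix q
  obtain U x where U: "(U, x) \<in> A" "q \<in> U" by (rule chart_at_cases)
  have f: "smooth_map_on A UNIV f" using assms(2) by (simp add: smooth_fun_def)
  have op: "open (x ` (U \<inter> UNIV))" using open_chart_image[OF U(1)] by blast
  have X: "smooth_on ((\<lambda>p. dif A x p (X p)) \<circ> inv_into U x) (x ` (U \<inter> UNIV))"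
    using smooth_map_onD[OF smooth_vfD[OF assms(1) U(1)] U(1)] by simp
  have "smooth_on (vf_apply A X f \<circ> inv_into U x) (x ` (U \<inter> UNIV))"
    by (rule smooth_on_cong[OF op _ smooth_on_frechet_apply[OF op smooth_map_onD[OF f U(1)] X]])
      (use dif_chart[OF f U(1)] chart_inv[OF U(1)] in \<open>auto simp: vf_apply_def\<close>)
  then show "\<exists>U x N. (U, x) \<in> A \<and> open N \<and> q \<in> N \<and> q \<in> U \<and>
      smooth_on (vf_apply A X f \<circ> inv_into U x) (x ` (U \<inter> N))"
    using U by blast
qed

text \<open>The set \<open>K\<close> is compact as the image of a ball, hence closed by the
  Hausdorff property. Its complement is then an open set on which the function vanishes and which,
  with \<open>U\<close>, covers the manifold.\<close>

lemma bump_function: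
  assumes "(U, x) \<in> A" "p \<in> U"
  obtains \<rho> :: "'m \<Rightarrow> real" and K where "smooth_fun A \<rho>" "\<rho> p = 1" "closed K" "K \<subseteq> U"
    "\<And>q. q \<notin> K \<Longrightarrow> \<rho> q = 0"
proof -
  obtain r where r: "r > 0" "cball (x p) r \<subseteq> x ` U"
    using chart_open_image[OF assms(1)] assms(2) open_contains_cball by blast
  obtain b :: "real ^ 'n \<Rightarrow> real" where b: "smooth_on b UNIV" "b (x p) = 1"
    "\<And>u. u \<notin> cball (x p) r \<Longrightarrow> b u = 0" using smooth_bump[OF r(1)] by blast
  define K where "K = inv_into U x ` cball (x p) r"
  define \<rho> where "\<rho> = (\<lambda>q. if q \<in> U then b (x q) else 0)"
  have KU: "K \<subseteq> U" using r(2) by (auto simp: K_def inv_into_into)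
  have "continuous_on (x ` U) (inv_into U x)"
    using chart_homeo[OF assms(1)] by (auto simp: homeomorphism_def)
  then have "compact K" unfolding K_def
    using r(2) by (meson compact_cball compact_continuous_image continuous_on_subset)
  then have K: "closed K" by (rule compact_imp_closed)
  have off: "\<rho> q = 0" if "q \<notin> K" for q
  proof (cases "q \<in> U")
    case True
    have "x q \<notin> cball (x p) r"
    proof
      assume "x q \<in> cball (x p) r"
      then have "inv_into U x (x q) \<in> K" unfolding K_def by blast
      then show False using that chart_inv[OF assms(1) True] by simp
    qed
    then show ?thesis by (simp add: \<rho>_def b(3))
  qed (simp add: \<rho>_def)
  have "smooth_fun A \<rho>" unfolding smooth_fun_def
  proof (rule smooth_map_on_local)
    fix q
    show "\<exists>N. open N \<and> q \<in> N \<and> smooth_map_on A N \<rho>"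
    proof (cases "q \<in> U")
      case True
      have op: "open (x ` (U \<inter> U))" using chart_open_image[OF assms(1)] by simp
      have "smooth_on (\<rho> \<circ> inv_into U x) (x ` (U \<inter> U))"
        by (rule smooth_on_cong[OF op _ smooth_on_subset[OF b(1) subset_UNIV]])
          (use chart_inv_image[OF assms(1), of _ U] in \<open>auto simp: \<rho>_def\<close>)
      then have "smooth_map_on A U \<rho>"
        using assms(1) chart_open[OF assms(1)] by (intro smooth_map_onI) blast
      then show ?thesis using True chart_open[OF assms(1)] by blast
    next
      case False
      have "smooth_map_on A (- K) \<rho>"
        using K off by (intro smooth_map_on_cong[OF _ _ smooth_map_on_const[of _ 0]]) auto
      then show ?thesis using False KU K by blast
    qed
  qed
  moreover have "\<rho> p = 1" using assms(2) b(2) by (simp add: \<rho>_def)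
  ultimately show ?thesis using that K KU off by blast
qed

text \<open>Off \<open>U\<close> the map \<open>f\<close> may be arbitrary: the product is smooth on
  \<open>U\<close> inside \<open>W\<close>, is zero on the complement of \<open>K\<close>, and these
  open sets cover \<open>W\<close>.\<close>

lemma smooth_map_on_extend_zero:
  assumes "smooth_fun A \<rho>" "closed K" "K \<subseteq> U" "\<And>q. q \<notin> K \<Longrightarrow> \<rho> q = 0" "open U" "open W"
    "smooth_map_on A (U \<inter> W) f"
  shows "smooth_map_on A W (\<lambda>q. \<rho> q *\<^sub>R f q)"
proof (rule smooth_map_on_local)
  fix q assume q: "q \<in> W"
  show "\<exists>N. open N \<and> q \<in> N \<and> smooth_map_on A N (\<lambda>q. \<rho> q *\<^sub>R f q)"
  proof (cases "q \<in> U")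
    case True
    have "smooth_map_on A (U \<inter> W) (\<lambda>q. \<rho> q *\<^sub>R f q)"
      using assms by (intro smooth_map_on_scaleR)
        (auto simp: smooth_fun_def intro: smooth_map_on_subset)
    then show ?thesis using True q assms by blast
  next
    case False
    have "smooth_map_on A (- K) (\<lambda>q. \<rho> q *\<^sub>R f q)"
      using assms by (intro smooth_map_on_cong[OF _ _ smooth_map_on_const[of _ 0]]) auto
    then show ?thesis using False assms by blast
  qed
qed

text \<open>The field on \<open>U\<close> whose components in the chart \<open>(U, x)\<close> are the constants \<open>w\<close>.\<close>

definition coord_field :: "'m set \<Rightarrow> ('m \<Rightarrow> real ^ 'n) \<Rightarrow> real ^ 'n \<Rightarrow> ('m, 'n) vfield" where
  "coord_field U x w q = frechet_derivative (snd (chart_at A q) \<circ> inv_into U x) (at (x q)) w"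

lemma dif_coord_field:
  assumes U: "(U, x) \<in> A" and V: "(V, y) \<in> A" and q: "q \<in> U" "q \<in> V"
  shows "dif A y q (coord_field U x w q) = frechet_derivative (y \<circ> inv_into U x) (at (x q)) w"
proof -
  obtain V' y' where V': "chart_at A q = (V', y')" "(V', y') \<in> A" "q \<in> V'" by (rule chart_at_cases)
  have "(y \<circ> inv_into U x has_derivative
      (\<lambda>v. dif A y q (frechet_derivative (y' \<circ> inv_into U x) (at (x q)) v))) (at (x q))"
    by (rule has_derivative_change_chart[OF V'(2) U V'(3) q(1) dif_has_derivative[OF chart_smooth[OF V] q(2) V'(1)]])
  then have "frechet_derivative (y \<circ> inv_into U x) (at (x q)) =
      (\<lambda>v. dif A y q (frechet_derivative (y' \<circ> inv_into U x) (at (x q)) v))"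
    using frechet_derivative_at by metis
  then show ?thesis by (simp add: coord_field_def V'(1))
qed

lemma coord_field_dif:
  assumes "(U, x) \<in> A" "q \<in> U"
  shows "coord_field U x (dif A x q v) q = v"
proof -
  obtain V y where V: "chart_at A q = (V, y)" "(V, y) \<in> A" "q \<in> V" by (rule chart_at_cases)
  have "coord_field U x (dif A x q v) q = dif A y q v"
    using dif_chart[OF chart_smooth[OF V(2)] assms V(3)] by (simp add: coord_field_def V(1))
  then show ?thesis by (simp add: dif_chart_at[OF V(1)])
qed

lemma coord_field_linear:
  assumes "(U, x) \<in> A" "q \<in> U" shows "linear (\<lambda>w. coord_field U x w q)"
proof -
  obtain V y where V: "chart_at A q = (V, y)" "(V, y) \<in> A" "q \<in> V" by (rule chart_at_cases)
  show ?thesis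
    using has_derivative_linear[OF smooth_map_on_has_derivative[OF chart_smooth[OF V(2)] assms V(3)]]
    by (simp add: coord_field_def V(1))
qed

lemma coord_field_cutoff_smooth:
  assumes U: "(U, x) \<in> A" and \<rho>: "smooth_fun A \<rho>" "closed K" "K \<subseteq> U" "\<And>q. q \<notin> K \<Longrightarrow> \<rho> q = 0"
  shows "smooth_vf A (\<lambda>q. \<rho> q *\<^sub>R coord_field U x w q)"
  unfolding smooth_vf_def
proof safe
  fix V y assume V: "(V, y) \<in> A"
  note oU = chart_open[OF U] and oV = chart_open[OF V]
  have op: "open (x ` (U \<inter> (U \<inter> V)))" using open_chart_image[OF U] oU oV by blast
  have sm: "smooth_on (\<lambda>u. frechet_derivative (y \<circ> inv_into U x) (at u) w) (x ` (U \<inter> (U \<inter> V)))"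
    using smooth_on_deriv[OF transition_smooth[OF U V]] by (simp add: Int_absorb Int_assoc[symmetric])
  have "smooth_on ((\<lambda>q. dif A y q (coord_field U x w q)) \<circ> inv_into U x) (x ` (U \<inter> (U \<inter> V)))"
    by (rule smooth_on_cong[OF op _ sm])
      (use chart_inv[OF U] dif_coord_field[OF U V] in auto)
  then have "smooth_map_on A (U \<inter> V) (\<lambda>q. dif A y q (coord_field U x w q))"
    using U oU oV by (intro smooth_map_onI) blast
  then have *: "smooth_map_on A V (\<lambda>q. \<rho> q *\<^sub>R dif A y q (coord_field U x w q))"
    using smooth_map_on_extend_zero[OF \<rho> oU oV] by blast
  show "smooth_map_on A V (\<lambda>q. dif A y q (\<rho> q *\<^sub>R coord_field U x w q))"
    by (rule smooth_map_on_cong[OF oV _ *]) (simp add: linear_cmul[OF dif_chart_linear[OF V]])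
qed

text \<open>Justifies the choice made in \<open>extend_vec\<close>: a coordinate field with the
  right value at \<open>p\<close>, cut off.\<close>

lemma ex_smooth_vf: "\<exists>X. smooth_vf A X \<and> X p = v"
proof -
  obtain U x where U: "(U, x) \<in> A" "p \<in> U" by (rule chart_at_cases)
  obtain \<rho> K where \<rho>: "smooth_fun A \<rho>" "\<rho> p = 1" "closed K" "K \<subseteq> U" "\<And>q. q \<notin> K \<Longrightarrow> \<rho> q = 0"
    using bump_function[OF U] by metis
  let ?X = "\<lambda>q. \<rho> q *\<^sub>R coord_field U x (dif A x p v) q"
  have "smooth_vf A ?X" by (rule coord_field_cutoff_smooth[OF U(1) \<rho>(1,3-5)])
  moreover have "?X p = v" by (simp add: \<rho>(2) coord_field_dif[OF U])
  ultimately show ?thesis by (intro exI[of _ ?X]) simp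
qed

lemma extend_vec: "smooth_vf A (extend_vec A p v)" "extend_vec A p v p = v"
  using someI_ex[OF ex_smooth_vf[of p v]] by (simp_all add: extend_vec_def)

section \<open>Tensoriality: dependence on the value at one point\<close>

lemma smooth_vf_zero: "smooth_vf A (\<lambda>p. 0)"
  using smooth_vf_scaleR[OF smooth_fun_const[of 0] extend_vec(1)] by simp

text \<open>In a chart, \<rho>^2 X is a combination of global fields \<open>E b\<close> with global
  coefficients \<open>C b\<close> that vanish at \<open>p\<close>, and \<open>T\<close> does not see
  \<rho>^2 because \<rho>(p) = 1. The square arises because coefficients and fields each have to be
  cut off.\<close>

lemma tensorial_zero:
  fixes T :: "('m, 'n) vfield \<Rightarrow> 'b::real_vector"
  assumes add: "\<And>X Y. smooth_vf A X \<Longrightarrow> smooth_vf A Y \<Longrightarrow> T (\<lambda>q. X q + Y q) = T X + T Y"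
    and scale: "\<And>f X. smooth_fun A f \<Longrightarrow> smooth_vf A X \<Longrightarrow> T (\<lambda>q. f q *\<^sub>R X q) = f p *\<^sub>R T X"
    and X: "smooth_vf A X" "X p = 0"
  shows "T X = 0"
proof -
  obtain U x where U: "(U, x) \<in> A" "p \<in> U" by (rule chart_at_cases)
  obtain \<rho> K where \<rho>: "smooth_fun A \<rho>" "\<rho> p = 1" "closed K" "K \<subseteq> U" "\<And>q. q \<notin> K \<Longrightarrow> \<rho> q = 0"
    using bump_function[OF U] by metis
  define E where "E = (\<lambda>b q. \<rho> q *\<^sub>R coord_field U x b q)"
  define C where "C = (\<lambda>b q. \<rho> q * (dif A x q (X q) \<bullet> b))"
  have E: "smooth_vf A (E b)" for b
    unfolding E_def by (rule coord_field_cutoff_smooth[OF U(1) \<rho>(1,3-5)])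
  have C: "smooth_fun A (C b)" for b
  proof -
    have "smooth_map_on A (U \<inter> UNIV) (\<lambda>q. dif A x q (X q) \<bullet> b)"
      using smooth_map_on_bounded_linear[OF chart_open[OF U(1)] smooth_vfD[OF X(1) U(1)]
          bounded_linear_inner_left] by simp
    then show ?thesis
      using smooth_map_on_extend_zero[OF \<rho>(1,3-5) chart_open[OF U(1)] open_UNIV,
          where f = "\<lambda>q. dif A x q (X q) \<bullet> b"]
      by (simp add: C_def smooth_fun_def)
  qed
  have zero: "T (\<lambda>q. 0) = 0" using scale[OF smooth_fun_const[of 0] X(1)] by simp
  have sum: "smooth_vf A (\<lambda>q. \<Sum>b\<in>B. C b q *\<^sub>R E b q) \<and>
      T (\<lambda>q. \<Sum>b\<in>B. C b q *\<^sub>R E b q) = (\<Sum>b\<in>B. C b p *\<^sub>R T (E b))" if "finite B" for B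
    using that
  proof (induction B rule: finite_induct)
    case empty
    then show ?case by (simp add: zero smooth_vf_zero)
  next
    case (insert b B)
    let ?S = "\<lambda>q. \<Sum>b\<in>B. C b q *\<^sub>R E b q"
    have CE: "smooth_vf A (\<lambda>q. C b q *\<^sub>R E b q)" by (rule smooth_vf_scaleR[OF C E])
    have S: "smooth_vf A ?S" "T ?S = (\<Sum>b\<in>B. C b p *\<^sub>R T (E b))" using insert.IH by auto
    have "(\<lambda>q. \<Sum>b\<in>insert b B. C b q *\<^sub>R E b q) = (\<lambda>q. C b q *\<^sub>R E b q + ?S q)"
      using insert.hyps by simp
    moreover have "T (\<lambda>q. C b q *\<^sub>R E b q + ?S q) = C b p *\<^sub>R T (E b) + (\<Sum>b\<in>B. C b p *\<^sub>R T (E b))"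
      by (simp only: add[OF CE S(1)] scale[OF C E] S(2))
    ultimately show ?case using insert.hyps smooth_vf_add[OF CE S(1)] by simp
  qed
  have "(\<Sum>b\<in>Basis. C b q *\<^sub>R E b q) = (\<rho> q * \<rho> q) *\<^sub>R X q" for q
  proof (cases "q \<in> U")
    case True
    have "(\<Sum>b\<in>Basis. C b q *\<^sub>R E b q)
        = (\<rho> q * \<rho> q) *\<^sub>R (\<Sum>b\<in>Basis. (dif A x q (X q) \<bullet> b) *\<^sub>R coord_field U x b q)"
      unfolding scaleR_sum_right by (intro sum.cong) (simp_all add: C_def E_def mult_ac)
    then show ?thesis
      by (simp add: linear_sum_Basis[OF coord_field_linear[OF U(1) True]] coord_field_dif[OF U(1) True])
  next
    case False
    then have "\<rho> q = 0" using \<rho> by blast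
    then show ?thesis by (simp add: C_def)
  qed
  then have "T (\<lambda>q. \<Sum>b\<in>Basis. C b q *\<^sub>R E b q) = T X"
    using scale[OF smooth_fun_mult[OF \<rho>(1,1)] X(1)] \<rho>(2) by simp
  moreover have "C b p = 0" for b
    using X(2) linear_0[OF dif_chart_linear[OF U]] by (simp add: C_def)
  ultimately show ?thesis using sum[of Basis] by simp
qed

lemma tensorial:
  fixes T :: "('m, 'n) vfield \<Rightarrow> 'b::real_vector"
  assumes add: "\<And>X Y. smooth_vf A X \<Longrightarrow> smooth_vf A Y \<Longrightarrow> T (\<lambda>q. X q + Y q) = T X + T Y"
    and scale: "\<And>f X. smooth_fun A f \<Longrightarrow> smooth_vf A X \<Longrightarrow> T (\<lambda>q. f q *\<^sub>R X q) = f p *\<^sub>R T X"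
    and X: "smooth_vf A X" "smooth_vf A Y" "X p = Y p"
  shows "T X = T Y"
proof -
  have Y': "smooth_vf A (\<lambda>q. (-1) *\<^sub>R Y q)" by (rule smooth_vf_scaleR[OF smooth_fun_const X(2)])
  have "T (\<lambda>q. X q + (-1) *\<^sub>R Y q) = 0"
    by (rule tensorial_zero[where T = T and p = p])
      (simp_all only: add scale smooth_vf_add[OF X(1) Y'], simp add: X(3))
  then have "T X + T (\<lambda>q. (-1) *\<^sub>R Y q) = 0" by (simp only: add[OF X(1) Y'])
  then show ?thesis by (simp only: scale[OF smooth_fun_const X(2)]) simp
qed

text \<open>Three fields because the frame has three members; coefficients 0 cover shorter
  combinations.\<close>

lemma tensorial_combination:
  fixes T :: "('m, 'n) vfield \<Rightarrow> 'b::real_vector"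
  assumes add: "\<And>X Y. smooth_vf A X \<Longrightarrow> smooth_vf A Y \<Longrightarrow> T (\<lambda>q. X q + Y q) = T X + T Y"
    and scale: "\<And>f X. smooth_fun A f \<Longrightarrow> smooth_vf A X \<Longrightarrow> T (\<lambda>q. f q *\<^sub>R X q) = f p *\<^sub>R T X"
    and sm: "smooth_vf A X" "smooth_vf A E" "smooth_vf A F" "smooth_vf A G"
    and X: "X p = a *\<^sub>R E p + b *\<^sub>R F p + c *\<^sub>R G p"
  shows "T X = a *\<^sub>R T E + b *\<^sub>R T F + c *\<^sub>R T G"
proof -
  have c: "smooth_vf A (\<lambda>q. r *\<^sub>R Y q)" if "smooth_vf A Y" for r Y
    by (rule smooth_vf_scaleR[OF smooth_fun_const that])
  have "T X = T (\<lambda>q. (a *\<^sub>R E q + b *\<^sub>R F q) + c *\<^sub>R G q)"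
    by (rule tensorial[where T = T and p = p, OF add scale sm(1) smooth_vf_add[OF smooth_vf_add[OF
            c[OF sm(2)] c[OF sm(3)]] c[OF sm(4)]] X])
  also have "\<dots> = a *\<^sub>R T E + b *\<^sub>R T F + c *\<^sub>R T G"
    by (simp only: add[OF smooth_vf_add[OF c[OF sm(2)] c[OF sm(3)]] c[OF sm(4)]]
        add[OF c[OF sm(2)] c[OF sm(3)]] scale[OF smooth_fun_const] sm)
  finally show ?thesis .
qed

lemma vf_apply_add:
  assumes "smooth_fun A f" "smooth_fun A h"
  shows "vf_apply A X (\<lambda>q. f q + h q) p = vf_apply A X f p + vf_apply A X h p"
  using assms unfolding vf_apply_def smooth_fun_def by (simp add: dif_add[where W = UNIV])

lemma vf_apply_mult:
  assumes "smooth_fun A f" "smooth_fun A h"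
  shows "vf_apply A X (\<lambda>q. f q * h q) p = f p * vf_apply A X h p + vf_apply A X f p * h p"
  using assms unfolding vf_apply_def smooth_fun_def by (simp add: dif_mult[where W = UNIV])

lemma vf_apply_const: "vf_apply A X (\<lambda>q. c) p = 0"
  by (simp add: vf_apply_def dif_const)

lemma vf_apply_diff:
  assumes "smooth_fun A f" "smooth_fun A h"
  shows "vf_apply A X (\<lambda>q. f q - h q) p = vf_apply A X f p - vf_apply A X h p"
proof -
  have "vf_apply A X (\<lambda>q. f q + (-1) * h q) p = vf_apply A X f p + vf_apply A X (\<lambda>q. (-1) * h q) p"
    by (rule vf_apply_add[OF assms(1) smooth_fun_mult[OF smooth_fun_const assms(2)]])
  also have "\<dots> = vf_apply A X f p - vf_apply A X h p"
    unfolding vf_apply_mult[OF smooth_fun_const assms(2)] vf_apply_const by simp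
  finally show ?thesis by simp
qed

subsection \<open>The Lie bracket\<close>

text \<open>Coordinate functions, cut off to be global, read off the components. This gives the
  uniqueness required by the description in \<open>lie_bracket\<close>.\<close>

lemma dif_separates:
  assumes "\<And>f. smooth_fun A f \<Longrightarrow> dif A f p v = dif A f p w"
  shows "v = w"
proof -
  obtain U x where U: "chart_at A p = (U, x)" "(U, x) \<in> A" "p \<in> U" by (rule chart_at_cases)
  obtain \<rho> K where \<rho>: "smooth_fun A \<rho>" "\<rho> p = 1" "closed K" "K \<subseteq> U" "\<And>q. q \<notin> K \<Longrightarrow> \<rho> q = 0"
    using bump_function[OF U(2,3)] by metis
  have "v $ i = w $ i" for i
  proof -
    have xi: "smooth_map_on A U (\<lambda>q. x q $ i)"
      by (rule smooth_map_on_bounded_linear[OF chart_open[OF U(2)] chart_smooth[OF U(2)] bounded_linear_vec_nth])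
    have \<rho>U: "smooth_map_on A U \<rho>" using \<rho>(1) unfolding smooth_fun_def by (rule smooth_map_on_subset) simp
    have "dif A x p = (\<lambda>v. v)" by (rule ext) (rule dif_chart_at[OF U(1)])
    then have "(x \<circ> inv_into U x has_derivative (\<lambda>v. v)) (at (x p))"
      using dif_has_derivative[OF chart_smooth[OF U(2)] U(3) U(1)] by simp
    then have "((\<lambda>q. x q $ i) \<circ> inv_into U x has_derivative (\<lambda>v. v $ i)) (at (x p))"
      using bounded_linear.has_derivative[OF bounded_linear_vec_nth] by (force simp: o_def)
    then have dxi: "dif A (\<lambda>q. x q $ i) p = (\<lambda>v. v $ i)" by (rule dif_eqI[OF U(1)])
    have "smooth_fun A (\<lambda>q. \<rho> q * x q $ i)"
      using smooth_map_on_extend_zero[OF \<rho>(1,3-5) chart_open[OF U(2)] open_UNIV,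
          where f = "\<lambda>q. x q $ i"] xi
      by (simp add: smooth_fun_def)
    \<comment> \<open>The product rule leaves a term with the derivative of \<rho>; testing on
      \<rho> itself makes it equal for \<open>v\<close> and \<open>w\<close>.\<close>
    then have f: "dif A (\<lambda>q. \<rho> q * x q $ i) p v = dif A (\<lambda>q. \<rho> q * x q $ i) p w"
      "dif A \<rho> p v = dif A \<rho> p w" using assms \<rho>(1) by blast+
    then show ?thesis by (simp add: dif_mult[OF \<rho>U xi U(3)] dxi \<rho>(2))
  qed
  then show ?thesis by (simp add: vec_eq_iff)
qed

text \<open>In a chart the second-order terms of XYf and YXf agree by symmetry of second
  derivatives. What remains is the derivative of \<open>f\<close> along DY(X) - DX(Y).\<close>

lemma ex_bracket:
  assumes X: "smooth_vf A X" and Y: "smooth_vf A Y"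
  shows "\<exists>v. \<forall>f. smooth_fun A f \<longrightarrow>
    dif A f p v = vf_apply A X (vf_apply A Y f) p - vf_apply A Y (vf_apply A X f) p"
proof -
  obtain U x where U: "chart_at A p = (U, x)" "(U, x) \<in> A" "p \<in> U" by (rule chart_at_cases)
  have op: "open (x ` U)" and xp: "x p \<in> x ` U" using chart_open_image U by auto
  \<comment> \<open>The components of a field in the chart at \<open>p\<close>, as a map on the
    chart image; at \<open>x p\<close> they are the value of the field itself.\<close>
  define loc where "loc = (\<lambda>X. (\<lambda>q. dif A x q (X q)) \<circ> inv_into U x)"
  have loc_smooth: "smooth_on (loc X) (x ` U)" if "smooth_vf A X" for X
    using smooth_map_onD[OF smooth_vfD[OF that U(2)] U(2)] by (simp add: loc_def)
  have loc_p: "loc X (x p) = X p" for X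
    by (simp add: loc_def chart_inv[OF U(2,3)] dif_chart_at[OF U(1)])
  have main: "vf_apply A X (vf_apply A Y f) p =
      frechet_derivative (\<lambda>z. frechet_derivative (f \<circ> inv_into U x) (at z) (Y p)) (at (x p)) (X p)
      + dif A f p (frechet_derivative (loc Y) (at (x p)) (X p))"
    if f: "smooth_fun A f" and X: "smooth_vf A X" and Y: "smooth_vf A Y" for f X Y
  proof -
    have f': "smooth_map_on A UNIV f" using f by (simp add: smooth_fun_def)
    have fx: "smooth_on (f \<circ> inv_into U x) (x ` U)" using smooth_map_onD[OF f' U(2)] by simp
    have df: "dif A f p = frechet_derivative (f \<circ> inv_into U x) (at (x p))"
      by (rule ext) (simp add: dif_def U(1))
    have 1: "((\<lambda>z. frechet_derivative (f \<circ> inv_into U x) (at z) (loc Y z)) has_derivative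
      (\<lambda>a. frechet_derivative (\<lambda>z. frechet_derivative (f \<circ> inv_into U x) (at z) (Y p)) (at (x p)) a
       + dif A f p (frechet_derivative (loc Y) (at (x p)) a))) (at (x p))"
      using frechet_derivative_apply_deriv[OF op xp fx loc_smooth[OF Y]] by (simp add: loc_p df)
    have "(vf_apply A Y f \<circ> inv_into U x has_derivative
      (\<lambda>a. frechet_derivative (\<lambda>z. frechet_derivative (f \<circ> inv_into U x) (at z) (Y p)) (at (x p)) a
       + dif A f p (frechet_derivative (loc Y) (at (x p)) a))) (at (x p))"
      by (rule has_derivative_transform_within_open[OF 1 op xp])
        (use dif_chart[OF f' U(2)] chart_inv[OF U(2)] in \<open>auto simp: vf_apply_def loc_def\<close>)
    then have "dif A (vf_apply A Y f) p =
      (\<lambda>a. frechet_derivative (\<lambda>z. frechet_derivative (f \<circ> inv_into U x) (at z) (Y p)) (at (x p)) a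
       + dif A f p (frechet_derivative (loc Y) (at (x p)) a))" by (rule dif_eqI[OF U(1)])
    then show ?thesis by (simp only: vf_apply_def[of A X])
  qed
  let ?v = "frechet_derivative (loc Y) (at (x p)) (X p) - frechet_derivative (loc X) (at (x p)) (Y p)"
  have "dif A f p ?v = vf_apply A X (vf_apply A Y f) p - vf_apply A Y (vf_apply A X f) p"
    if f: "smooth_fun A f" for f
  proof -
    have f': "smooth_map_on A UNIV f" using f by (simp add: smooth_fun_def)
    have fx: "smooth_on (f \<circ> inv_into U x) (x ` U)" using smooth_map_onD[OF f' U(2)] by simp
    show ?thesis
      using second_derivative_symmetric[OF op xp fx, of "Y p" "X p"]
      by (simp add: main[OF f X Y] main[OF f Y X] linear_diff[OF dif_linear[OF f' UNIV_I]])
  qed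
  then show ?thesis by blast
qed

text \<open>Existence by \<open>ex_bracket\<close> and uniqueness by \<open>dif_separates\<close>
  let the definite description in \<open>lie_bracket\<close> be unfolded.\<close>

lemma vf_apply_bracket:
  assumes "smooth_vf A X" "smooth_vf A Y" "smooth_fun A f"
  shows "vf_apply A (lie_bracket A X Y) f p
    = vf_apply A X (vf_apply A Y f) p - vf_apply A Y (vf_apply A X f) p"
proof -
  obtain v where v: "\<forall>f. smooth_fun A f \<longrightarrow>
    dif A f p v = vf_apply A X (vf_apply A Y f) p - vf_apply A Y (vf_apply A X f) p"
    using ex_bracket[OF assms(1,2)] by blast
  have "lie_bracket A X Y p = v"
    unfolding lie_bracket_def
  proof (rule the_equality)
    show "\<forall>f. smooth_fun A f \<longrightarrow>
      dif A f p v = vf_apply A X (vf_apply A Y f) p - vf_apply A Y (vf_apply A X f) p" by (rule v)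
  next
    fix w assume w: "\<forall>f. smooth_fun A f \<longrightarrow>
      dif A f p w = vf_apply A X (vf_apply A Y f) p - vf_apply A Y (vf_apply A X f) p"
    show "w = v" by (rule dif_separates[of p]) (use v w in metis)
  qed
  then show ?thesis using v assms(3) by (simp add: vf_apply_def)
qed

end

section \<open>Curvature of a pseudo-Riemannian manifold\<close>

locale pseudo_riemannian_manifold = smooth_manifold A
  for A :: "('m::{t2_space, second_countable_topology}, 'n::finite) chart set" +
  fixes g :: "'m \<Rightarrow> real ^ 'n \<Rightarrow> real ^ 'n \<Rightarrow> real" and nab :: "('m, 'n) conn"
  assumes metric: "pseudo_riemannian A g" and lc: "levi_civita A g nab"
begin

abbreviation "R \<equiv> curvature A nab"

lemma g_add: "g p (u + v) w = g p u w + g p v w" "g p w (u + v) = g p w u + g p w v"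
  and g_scaleR: "g p (c *\<^sub>R u) w = c * g p u w" "g p w (c *\<^sub>R u) = c * g p w u"
  and g_diff: "g p (u - v) w = g p u w - g p v w" "g p w (u - v) = g p w u - g p w v"
  and g_minus: "g p (- u) w = - g p u w" "g p w (- u) = - g p w u"
  and g_zero: "g p 0 w = 0" "g p w 0 = 0"
  and g_sym: "g p v w = g p w v"
proof -
  have b: "bilinear (g p)" for p using metric by (simp add: pseudo_riemannian_def)
  show "g p (u + v) w = g p u w + g p v w" "g p w (u + v) = g p w u + g p w v"
    by (simp_all add: bilinear_ladd[OF b] bilinear_radd[OF b])
  show "g p (c *\<^sub>R u) w = c * g p u w" "g p w (c *\<^sub>R u) = c * g p w u"
    by (simp_all add: bilinear_lmul[OF b] bilinear_rmul[OF b])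
  show "g p (u - v) w = g p u w - g p v w" "g p w (u - v) = g p w u - g p w v"
    by (simp_all add: bilinear_lsub[OF b] bilinear_rsub[OF b])
  show "g p (- u) w = - g p u w" "g p w (- u) = - g p w u"
    by (simp_all add: bilinear_lneg[OF b] bilinear_rneg[OF b])
  show "g p 0 w = 0" "g p w 0 = 0"
    by (simp_all add: bilinear_lzero[OF b] bilinear_rzero[OF b])
  show "g p v w = g p w v" using metric unfolding pseudo_riemannian_def by blast
qed

lemma g_smooth: "smooth_vf A X \<Longrightarrow> smooth_vf A Y \<Longrightarrow> smooth_fun A (\<lambda>p. g p (X p) (Y p))"
  using metric by (simp add: pseudo_riemannian_def)

lemma nab_smooth: "smooth_vf A X \<Longrightarrow> smooth_vf A Y \<Longrightarrow> smooth_vf A (nab X Y)"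
  and nab_add_left: "smooth_vf A X \<Longrightarrow> smooth_vf A X' \<Longrightarrow> smooth_vf A Y \<Longrightarrow>
    nab (\<lambda>p. X p + X' p) Y = (\<lambda>p. nab X Y p + nab X' Y p)"
  and nab_scaleR_left: "smooth_fun A f \<Longrightarrow> smooth_vf A X \<Longrightarrow> smooth_vf A Y \<Longrightarrow>
    nab (\<lambda>p. f p *\<^sub>R X p) Y = (\<lambda>p. f p *\<^sub>R nab X Y p)"
  and nab_add_right: "smooth_vf A X \<Longrightarrow> smooth_vf A Y \<Longrightarrow> smooth_vf A Y' \<Longrightarrow>
    nab X (\<lambda>p. Y p + Y' p) = (\<lambda>p. nab X Y p + nab X Y' p)"
  and nab_scaleR_right: "smooth_fun A f \<Longrightarrow> smooth_vf A X \<Longrightarrow> smooth_vf A Y \<Longrightarrow>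
    nab X (\<lambda>p. f p *\<^sub>R Y p) = (\<lambda>p. vf_apply A X f p *\<^sub>R Y p + f p *\<^sub>R nab X Y p)"
proof -
  note ac = lc[unfolded levi_civita_def affine_connection_def, THEN conjunct1]
  show "smooth_vf A X \<Longrightarrow> smooth_vf A Y \<Longrightarrow> smooth_vf A (nab X Y)"
    by (rule ac[THEN conjunct1, rule_format])
  show "smooth_vf A X \<Longrightarrow> smooth_vf A X' \<Longrightarrow> smooth_vf A Y \<Longrightarrow>
    nab (\<lambda>p. X p + X' p) Y = (\<lambda>p. nab X Y p + nab X' Y p)"
    by (rule ac[THEN conjunct2, THEN conjunct1, rule_format])
  show "smooth_fun A f \<Longrightarrow> smooth_vf A X \<Longrightarrow> smooth_vf A Y \<Longrightarrow>
    nab (\<lambda>p. f p *\<^sub>R X p) Y = (\<lambda>p. f p *\<^sub>R nab X Y p)"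
    by (rule ac[THEN conjunct2, THEN conjunct2, THEN conjunct1, rule_format])
  show "smooth_vf A X \<Longrightarrow> smooth_vf A Y \<Longrightarrow> smooth_vf A Y' \<Longrightarrow>
    nab X (\<lambda>p. Y p + Y' p) = (\<lambda>p. nab X Y p + nab X Y' p)"
    by (rule ac[THEN conjunct2, THEN conjunct2, THEN conjunct2, THEN conjunct1, rule_format])
  show "smooth_fun A f \<Longrightarrow> smooth_vf A X \<Longrightarrow> smooth_vf A Y \<Longrightarrow>
    nab X (\<lambda>p. f p *\<^sub>R Y p) = (\<lambda>p. vf_apply A X f p *\<^sub>R Y p + f p *\<^sub>R nab X Y p)"
    by (rule ac[THEN conjunct2, THEN conjunct2, THEN conjunct2, THEN conjunct2, rule_format])
qed

lemma nab_diff_left: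
  assumes "smooth_vf A X" "smooth_vf A X'" "smooth_vf A Y"
  shows "nab (\<lambda>p. X p - X' p) Y = (\<lambda>p. nab X Y p - nab X' Y p)"
proof -
  have "nab (\<lambda>p. X p + (-1) *\<^sub>R X' p) Y = (\<lambda>p. nab X Y p + (-1) *\<^sub>R nab X' Y p)"
    unfolding nab_add_left[OF assms(1) smooth_vf_scaleR[OF smooth_fun_const assms(2)] assms(3)]
      nab_scaleR_left[OF smooth_fun_const assms(2,3)] ..
  then show ?thesis by simp
qed

lemma nab_diff_right:
  assumes "smooth_vf A X" "smooth_vf A Y" "smooth_vf A Y'"
  shows "nab X (\<lambda>p. Y p - Y' p) = (\<lambda>p. nab X Y p - nab X Y' p)"
proof -
  have "nab X (\<lambda>p. Y p + (-1) *\<^sub>R Y' p) = (\<lambda>p. nab X Y p + (-1) *\<^sub>R nab X Y' p)"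
    unfolding nab_add_right[OF assms(1,2) smooth_vf_scaleR[OF smooth_fun_const assms(3)]]
      nab_scaleR_right[OF smooth_fun_const assms(1,3)] vf_apply_const by simp
  then show ?thesis by simp
qed

lemma nab_zero_right: "smooth_vf A X \<Longrightarrow> nab X (\<lambda>p. 0) = (\<lambda>p. 0)"
  using nab_diff_right[of X X X] by simp

lemma bracket: "smooth_vf A X \<Longrightarrow> smooth_vf A Y \<Longrightarrow> lie_bracket A X Y = (\<lambda>p. nab X Y p - nab Y X p)"
  by (rule ext, rule sym) (use lc in \<open>simp add: levi_civita_def\<close>)

lemma bracket_smooth: "smooth_vf A X \<Longrightarrow> smooth_vf A Y \<Longrightarrow> smooth_vf A (lie_bracket A X Y)"
  by (simp add: bracket smooth_vf_diff nab_smooth)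

lemma nab_metric:
  "smooth_vf A X \<Longrightarrow> smooth_vf A Y \<Longrightarrow> smooth_vf A Z \<Longrightarrow>
    vf_apply A X (\<lambda>q. g q (Y q) (Z q)) = (\<lambda>p. g p (nab X Y p) (Z p) + g p (Y p) (nab X Z p))"
  by (rule ext, rule lc[unfolded levi_civita_def, THEN conjunct2, THEN conjunct2, rule_format])

lemma R_smooth:
  "smooth_vf A X \<Longrightarrow> smooth_vf A Y \<Longrightarrow> smooth_vf A Z \<Longrightarrow> smooth_vf A (R X Y Z)"
  unfolding curvature_def by (intro smooth_vf_diff nab_smooth bracket_smooth)

section \<open>Tensoriality and symmetries of the curvature\<close>

lemma R_skew:
  assumes "smooth_vf A X" "smooth_vf A Y" "smooth_vf A Z"
  shows "R Y X Z = (\<lambda>p. - R X Y Z p)"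
  unfolding curvature_def bracket[OF assms(1,2)] bracket[OF assms(2,1)]
    nab_diff_left[OF nab_smooth[OF assms(1,2)] nab_smooth[OF assms(2,1)] assms(3)]
    nab_diff_left[OF nab_smooth[OF assms(2,1)] nab_smooth[OF assms(1,2)] assms(3)] by (simp add: algebra_simps)

lemma R_add:
  assumes X: "smooth_vf A X" "smooth_vf A X'" and Y: "smooth_vf A Y" and Z: "smooth_vf A Z"
  shows "R (\<lambda>p. X p + X' p) Y Z = (\<lambda>p. R X Y Z p + R X' Y Z p)"
proof -
  note XX = smooth_vf_add[OF X]
  have "lie_bracket A (\<lambda>p. X p + X' p) Y = (\<lambda>p. lie_bracket A X Y p + lie_bracket A X' Y p)"
    unfolding bracket[OF XX Y] bracket[OF X(1) Y] bracket[OF X(2) Y]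
      nab_add_left[OF X Y] nab_add_right[OF Y X] by (simp add: algebra_simps)
  then show ?thesis
    unfolding curvature_def
    by (simp only: nab_add_left[OF X nab_smooth[OF Y Z]] nab_add_left[OF X Z]
        nab_add_right[OF Y nab_smooth[OF X(1) Z] nab_smooth[OF X(2) Z]]
        nab_add_left[OF bracket_smooth[OF X(1) Y] bracket_smooth[OF X(2) Y] Z])
      (simp add: algebra_simps)
qed

text \<open>Since [fX, Y] = f[X, Y] - (Yf)X, the bracket term cancels the derivative of
  \<open>f\<close> produced by \<open>nab Y\<close>.\<close>

lemma R_scaleR:
  assumes f: "smooth_fun A f" and X: "smooth_vf A X" and Y: "smooth_vf A Y" and Z: "smooth_vf A Z"
  shows "R (\<lambda>p. f p *\<^sub>R X p) Y Z = (\<lambda>p. f p *\<^sub>R R X Y Z p)"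
proof -
  note fX = smooth_vf_scaleR[OF f X] and Yf = vf_apply_smooth[OF Y f] and XY = bracket_smooth[OF X Y]
  have "lie_bracket A (\<lambda>p. f p *\<^sub>R X p) Y = (\<lambda>p. f p *\<^sub>R lie_bracket A X Y p - vf_apply A Y f p *\<^sub>R X p)"
    unfolding bracket[OF fX Y] bracket[OF X Y] nab_scaleR_left[OF f X Y] nab_scaleR_right[OF f Y X]
    by (simp add: algebra_simps)
  moreover have "nab (\<lambda>p. f p *\<^sub>R lie_bracket A X Y p - vf_apply A Y f p *\<^sub>R X p) Z
      = (\<lambda>p. f p *\<^sub>R nab (lie_bracket A X Y) Z p - vf_apply A Y f p *\<^sub>R nab X Z p)"
    by (simp only: nab_diff_left[OF smooth_vf_scaleR[OF f XY] smooth_vf_scaleR[OF Yf X] Z]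
        nab_scaleR_left[OF f XY Z] nab_scaleR_left[OF Yf X Z])
  ultimately show ?thesis
    unfolding curvature_def
    by (simp only: nab_scaleR_left[OF f X nab_smooth[OF Y Z]] nab_scaleR_left[OF f X Z]
        nab_scaleR_right[OF f Y nab_smooth[OF X Z]]) (simp add: algebra_simps)
qed

lemma R_combination:
  assumes "smooth_vf A X" "smooth_vf A E" "smooth_vf A F" "smooth_vf A G" "smooth_vf A Y" "smooth_vf A Z"
    and "X p = a *\<^sub>R E p + b *\<^sub>R F p + c *\<^sub>R G p"
  shows "R X Y Z p = a *\<^sub>R R E Y Z p + b *\<^sub>R R F Y Z p + c *\<^sub>R R G Y Z p"
  by (rule tensorial_combination[where T = "\<lambda>X. R X Y Z p", OF _ _ assms(1-4,7)])
    (simp_all only: R_add[OF _ _ assms(5,6)] R_scaleR[OF _ _ assms(5,6)])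

lemma R_cong:
  assumes "smooth_vf A X" "smooth_vf A X'" "smooth_vf A Y" "smooth_vf A Z" "X p = X' p"
  shows "R X Y Z p = R X' Y Z p"
  using R_combination[OF assms(1,2,2,2,3,4), of p 1 0 0] assms(5) by simp

text \<open>Apply XY - YX - [X, Y], which annihilates functions, to g(Z, V). By metricity the mixed
  terms, such as g(\<open>nab Y Z\<close>, \<open>nab X V\<close>), cancel in pairs and the
  curvature terms remain.\<close>

lemma R_metric_skew:
  assumes X: "smooth_vf A X" and Y: "smooth_vf A Y" and Z: "smooth_vf A Z" and V: "smooth_vf A V"
  shows "g p (R X Y Z p) (V p) = - g p (Z p) (R X Y V p)"
proof -
  let ?f = "\<lambda>q. g q (Z q) (V q)"
  have second: "vf_apply A X (vf_apply A Y ?f) p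
      = g p (nab X (nab Y Z) p) (V p) + g p (nab Y Z p) (nab X V p)
      + (g p (nab X Z p) (nab Y V p) + g p (Z p) (nab X (nab Y V) p))"
    if X: "smooth_vf A X" and Y: "smooth_vf A Y" for X Y
    unfolding nab_metric[OF Y Z V]
      vf_apply_add[OF g_smooth[OF nab_smooth[OF Y Z] V] g_smooth[OF Z nab_smooth[OF Y V]]]
      nab_metric[OF X nab_smooth[OF Y Z] V] nab_metric[OF X Z nab_smooth[OF Y V]] ..
  have "vf_apply A (lie_bracket A X Y) ?f p
      = g p (nab (lie_bracket A X Y) Z p) (V p) + g p (Z p) (nab (lie_bracket A X Y) V p)"
    unfolding nab_metric[OF bracket_smooth[OF X Y] Z V] ..
  then show ?thesis
    using vf_apply_bracket[OF X Y g_smooth[OF Z V], of p]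
    unfolding second[OF X Y] second[OF Y X]
    by (simp add: curvature_def g_diff)
qed

text \<open>A tangent vector is determined by its action on functions, and as operators on functions
  the twelve triple products cancel.\<close>

lemma jacobi:
  assumes X: "smooth_vf A X" and Y: "smooth_vf A Y" and Z: "smooth_vf A Z"
  shows "lie_bracket A X (lie_bracket A Y Z) p + lie_bracket A Y (lie_bracket A Z X) p
    + lie_bracket A Z (lie_bracket A X Y) p = 0" (is "?v = 0")
proof (rule dif_separates[of p])
  fix f assume f: "smooth_fun A f"
  note sm = assms bracket_smooth vf_apply_smooth f
  have lin: "linear (dif A f p)" using f dif_linear[of UNIV] by (simp add: smooth_fun_def)
  have double: "dif A f p (lie_bracket A X (lie_bracket A Y Z) p)
      = vf_apply A X (vf_apply A Y (vf_apply A Z f)) p - vf_apply A X (vf_apply A Z (vf_apply A Y f)) p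
      - (vf_apply A Y (vf_apply A Z (vf_apply A X f)) p - vf_apply A Z (vf_apply A Y (vf_apply A X f)) p)"
    if X: "smooth_vf A X" and Y: "smooth_vf A Y" and Z: "smooth_vf A Z" for X Y Z
  proof -
    have "vf_apply A (lie_bracket A Y Z) f = (\<lambda>q. vf_apply A Y (vf_apply A Z f) q - vf_apply A Z (vf_apply A Y f) q)"
      by (rule ext) (rule vf_apply_bracket[OF Y Z f])
    then have "vf_apply A X (vf_apply A (lie_bracket A Y Z) f) p
        = vf_apply A X (vf_apply A Y (vf_apply A Z f)) p - vf_apply A X (vf_apply A Z (vf_apply A Y f)) p"
      by (simp only: vf_apply_diff[OF vf_apply_smooth[OF Y vf_apply_smooth[OF Z f]]
          vf_apply_smooth[OF Z vf_apply_smooth[OF Y f]]])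
    then show ?thesis
      using vf_apply_bracket[OF X bracket_smooth[OF Y Z] f, of p]
        vf_apply_bracket[OF Y Z vf_apply_smooth[OF X f], of p]
      by (simp add: vf_apply_def[of A "lie_bracket A X (lie_bracket A Y Z)"])
  qed
  show "dif A f p ?v = dif A f p 0"
    by (simp add: linear_add[OF lin] linear_0[OF lin] double[OF X Y Z] double[OF Y Z X] double[OF Z X Y])
qed

text \<open>Vanishing torsion rewrites each double bracket by \<open>nab\<close>, so that the cyclic
  sum becomes the Jacobi identity.\<close>

lemma bianchi:
  assumes X: "smooth_vf A X" and Y: "smooth_vf A Y" and Z: "smooth_vf A Z"
  shows "R X Y Z p + R Y Z X p + R Z X Y p = 0"
proof -
  have b: "lie_bracket A X (lie_bracket A Y Z) p
      = nab X (nab Y Z) p - nab X (nab Z Y) p - nab (lie_bracket A Y Z) X p"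
    if X: "smooth_vf A X" and Y: "smooth_vf A Y" and Z: "smooth_vf A Z" for X Y Z
    using nab_diff_right[OF X nab_smooth[OF Y Z] nab_smooth[OF Z Y]]
    by (simp add: bracket[OF X bracket_smooth[OF Y Z]]) (simp add: bracket[OF Y Z])
  show ?thesis
    using jacobi[OF assms, of p]
    by (simp add: b[OF X Y Z] b[OF Y Z X] b[OF Z X Y] curvature_def algebra_simps)
qed

section \<open>Covariant derivative of the curvature\<close>

lemma nabla_R_skew:
  assumes "smooth_vf A W" "smooth_vf A X" "smooth_vf A Y" "smooth_vf A Z"
  shows "nabla_curvature A nab W Y X Z p = - nabla_curvature A nab W X Y Z p"
proof -
  note W = assms(1) and X = assms(2) and Y = assms(3) and Z = assms(4)
  have "nab W (\<lambda>p. 0 - R X Y Z p) = (\<lambda>p. 0 - nab W (R X Y Z) p)"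
    unfolding nab_diff_right[OF W smooth_vf_zero R_smooth[OF X Y Z]] nab_zero_right[OF W] ..
  then have "nab W (R Y X Z) = (\<lambda>p. - nab W (R X Y Z) p)"
    unfolding R_skew[OF X Y Z] by simp
  then show ?thesis
    unfolding nabla_curvature_def R_skew[OF nab_smooth[OF W X] Y Z] R_skew[OF X nab_smooth[OF W Y] Z]
      R_skew[OF X Y nab_smooth[OF W Z]] by simp
qed

text \<open>The term (Wf) R(X, Y)Z arises once from differentiating f R(X, Y)Z and once from
  R(\<open>nab W (fX)\<close>, Y)Z, with opposite signs. The second slot is reached through
  \<open>nabla_R_skew\<close>.\<close>

lemma nabla_R_combination:
  assumes W: "smooth_vf A W" and "smooth_vf A X" "smooth_vf A E" "smooth_vf A F" "smooth_vf A G"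
    and Y: "smooth_vf A Y" and Z: "smooth_vf A Z"
    and "X p = a *\<^sub>R E p + b *\<^sub>R F p + c *\<^sub>R G p"
  shows "nabla_curvature A nab W X Y Z p = a *\<^sub>R nabla_curvature A nab W E Y Z p
    + b *\<^sub>R nabla_curvature A nab W F Y Z p + c *\<^sub>R nabla_curvature A nab W G Y Z p"
proof (rule tensorial_combination[where T = "\<lambda>X. nabla_curvature A nab W X Y Z p", OF _ _ assms(2-5,8)])
  fix X X' assume X: "smooth_vf A X" "smooth_vf A X'"
  show "nabla_curvature A nab W (\<lambda>q. X q + X' q) Y Z p
      = nabla_curvature A nab W X Y Z p + nabla_curvature A nab W X' Y Z p"
    unfolding nabla_curvature_def R_add[OF X Y Z] R_add[OF X nab_smooth[OF W Y] Z]
      R_add[OF X Y nab_smooth[OF W Z]] nab_add_right[OF W X]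
      R_add[OF nab_smooth[OF W X(1)] nab_smooth[OF W X(2)] Y Z]
      nab_add_right[OF W R_smooth[OF X(1) Y Z] R_smooth[OF X(2) Y Z]] by simp
next
  fix f X assume f: "smooth_fun A f" and X: "smooth_vf A X"
  have "R (\<lambda>q. vf_apply A W f q *\<^sub>R X q + f q *\<^sub>R nab W X q) Y Z
      = (\<lambda>q. vf_apply A W f q *\<^sub>R R X Y Z q + f q *\<^sub>R R (nab W X) Y Z q)"
    unfolding R_add[OF smooth_vf_scaleR[OF vf_apply_smooth[OF W f] X]
        smooth_vf_scaleR[OF f nab_smooth[OF W X]] Y Z]
      R_scaleR[OF vf_apply_smooth[OF W f] X Y Z] R_scaleR[OF f nab_smooth[OF W X] Y Z] ..
  then show "nabla_curvature A nab W (\<lambda>q. f q *\<^sub>R X q) Y Z p = f p *\<^sub>R nabla_curvature A nab W X Y Z p"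
    unfolding nabla_curvature_def R_scaleR[OF f X Y Z] R_scaleR[OF f X nab_smooth[OF W Y] Z]
      R_scaleR[OF f X Y nab_smooth[OF W Z]] nab_scaleR_right[OF f W X]
      nab_scaleR_right[OF f W R_smooth[OF X Y Z]]
    by (simp add: algebra_simps)
qed

end

section \<open>Three-dimensional quasi-para-Sasakian manifolds\<close>

lemma linear_functional_expand:
  fixes F :: "real ^ 'n \<Rightarrow> real"
  assumes "linear F" shows "(\<Sum>i\<in>UNIV. F (axis i 1) * y $ i) = F y"
proof -
  have "F y = F (\<Sum>i\<in>UNIV. (y $ i) *\<^sub>R axis i 1)"
    using basis_expansion[of y] by (simp add: scalar_mult_eq_scaleR)
  also have "\<dots> = (\<Sum>i\<in>UNIV. F (axis i 1) * y $ i)"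
    using assms by (simp add: linear_sum linear_cmul mult.commute)
  finally show ?thesis by simp
qed

locale quasi_para_Sasakian_3 = smooth_manifold A
  for A :: "('m::{t2_space, second_countable_topology}, 3) chart set" +
  fixes \<phi> :: "'m \<Rightarrow> real ^ 3 \<Rightarrow> real ^ 3" and \<eta> :: "'m \<Rightarrow> real ^ 3 \<Rightarrow> real" and \<xi> :: "('m, 3) vfield"
    and g :: "'m \<Rightarrow> real ^ 3 \<Rightarrow> real ^ 3 \<Rightarrow> real" and nab :: "('m, 3) conn"
  assumes qps: "quasi_para_Sasakian A \<phi> \<eta> \<xi> g nab"

sublocale quasi_para_Sasakian_3 \<subseteq> pseudo_riemannian_manifold A g nab
  using qps by unfold_locales (auto simp: quasi_para_Sasakian_def almost_paracontact_metric_def)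

context quasi_para_Sasakian_3
begin

section \<open>Structure tensors and the curvature in direction \<xi>\<close>

lemma apm: "almost_paracontact_metric A \<phi> \<eta> \<xi> g"
  using qps by (simp add: quasi_para_Sasakian_def)

lemma phi_linear: "linear (\<phi> p)" and phi_smooth: "smooth_vf A X \<Longrightarrow> smooth_vf A (\<lambda>q. \<phi> q (X q))"
  and eta_linear: "linear (\<eta> p)" and eta_smooth: "smooth_vf A X \<Longrightarrow> smooth_fun A (\<lambda>q. \<eta> q (X q))"
  and xi_smooth: "smooth_vf A \<xi>"
  and phi_xi: "\<phi> p (\<xi> p) = 0" and eta_phi: "\<eta> p (\<phi> p v) = 0" and eta_xi: "\<eta> p (\<xi> p) = 1"
  and phi_phi: "\<phi> p (\<phi> p v) = v - \<eta> p v *\<^sub>R \<xi> p"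
  and g_phi_phi: "g p (\<phi> p v) (\<phi> p w) = - g p v w + \<eta> p v * \<eta> p w"
  using apm by (simp_all add: almost_paracontact_metric_def smooth_endo_def smooth_one_form_def)

lemma phi_simps: "\<phi> p (u + v) = \<phi> p u + \<phi> p v" "\<phi> p (c *\<^sub>R u) = c *\<^sub>R \<phi> p u" "\<phi> p (u - v) = \<phi> p u - \<phi> p v"
    "\<phi> p 0 = 0"
  and eta_simps: "\<eta> p (u + v) = \<eta> p u + \<eta> p v" "\<eta> p (c *\<^sub>R u) = c * \<eta> p u" "\<eta> p (u - v) = \<eta> p u - \<eta> p v"
    "\<eta> p 0 = 0"
  using linear_add[OF phi_linear] linear_cmul[OF phi_linear] linear_diff[OF phi_linear] linear_0[OF phi_linear]
    linear_add[OF eta_linear] linear_cmul[OF eta_linear] linear_diff[OF eta_linear] linear_0[OF eta_linear]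
  by simp_all

lemma g_xi: "g p v (\<xi> p) = \<eta> p v" "g p (\<xi> p) v = \<eta> p v"
proof -
  show "g p v (\<xi> p) = \<eta> p v"
    using g_phi_phi[of p v "\<xi> p"] by (simp add: phi_xi g_zero eta_xi)
  then show "g p (\<xi> p) v = \<eta> p v" by (simp add: g_sym)
qed

lemma g_phi_skew: "g p (\<phi> p v) w = - g p v (\<phi> p w)"
  using g_phi_phi[of p v "\<phi> p w"] by (simp add: phi_phi eta_phi g_diff g_scaleR g_xi)

lemma g_phi_self: "g p v (\<phi> p v) = 0"
  using g_phi_skew[of p v v] g_sym[of p v "\<phi> p v"] by simp

lemma nab_phi:
  assumes "smooth_vf A X" "smooth_vf A Y"
  shows "nab X (\<lambda>q. \<phi> q (Y q)) = (\<lambda>p. \<phi> p (nab X Y p) + (g p (X p) (Y p) *\<^sub>R \<xi> p - \<eta> p (Y p) *\<^sub>R X p))"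
proof
  fix p
  have "nabla_endo nab \<phi> X Y p = g p (X p) (Y p) *\<^sub>R \<xi> p - \<eta> p (Y p) *\<^sub>R X p"
    using qps assms unfolding quasi_para_Sasakian_def by blast
  then show "nab X (\<lambda>q. \<phi> q (Y q)) p
      = \<phi> p (nab X Y p) + (g p (X p) (Y p) *\<^sub>R \<xi> p - \<eta> p (Y p) *\<^sub>R X p)"
    by (simp add: nabla_endo_def algebra_simps)
qed

text \<open>The structure equation at Y = \<xi> determines \<phi>(\<open>nab X \<xi>\<close>).
  Applying \<phi> recovers \<open>nab X \<xi>\<close> up to its \<xi> component, which is zero
  because g(\<xi>, \<xi>) = 1 is constant.\<close>

lemma nab_xi:
  assumes X: "smooth_vf A X" shows "nab X \<xi> = (\<lambda>p. \<phi> p (X p))"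
proof
  fix p
  have "2 * \<eta> p (nab X \<xi> p) = 0"
    using fun_cong[OF nab_metric[OF X xi_smooth xi_smooth], of p]
    by (simp add: g_xi eta_xi vf_apply_const)
  then have eta0: "\<eta> p (nab X \<xi> p) = 0" by simp
  have "0 = \<phi> p (nab X \<xi> p) + (\<eta> p (X p) *\<^sub>R \<xi> p - X p)"
    using fun_cong[OF nab_phi[OF X xi_smooth], of p] fun_cong[OF nab_zero_right[OF X], of p]
    by (simp add: phi_xi g_xi eta_xi)
  then have "\<phi> p (nab X \<xi> p) = X p - \<eta> p (X p) *\<^sub>R \<xi> p" by (simp add: algebra_simps)
  then have "\<phi> p (\<phi> p (nab X \<xi> p)) = \<phi> p (X p)" by (simp add: phi_simps phi_xi)
  then show "nab X \<xi> p = \<phi> p (X p)" by (simp add: phi_phi eta0)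
qed

text \<open>With \<open>nab_xi\<close> the curvature is \<open>nab X (\<phi> Y)\<close> -
  \<open>nab Y (\<phi> X)\<close> - \<phi>[X, Y]. The terms \<phi>(\<open>nab X Y\<close>) and
  \<phi>(\<open>nab Y X\<close>) cancel against the bracket, leaving the right-hand sides of the
  structure equation.\<close>

lemma R_xi:
  assumes X: "smooth_vf A X" and Y: "smooth_vf A Y"
  shows "R X Y \<xi> p = \<eta> p (X p) *\<^sub>R Y p - \<eta> p (Y p) *\<^sub>R X p"
proof -
  have "nab (lie_bracket A X Y) \<xi> p = \<phi> p (nab X Y p) - \<phi> p (nab Y X p)"
    unfolding nab_xi[OF bracket_smooth[OF X Y]] unfolding bracket[OF X Y] by (rule phi_simps(3))
  then show ?thesis
    unfolding curvature_def nab_xi[OF X] nab_xi[OF Y] nab_phi[OF X Y] nab_phi[OF Y X]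
    by (simp add: g_sym[of p "X p" "Y p"])
qed

text \<open>\<eta> is the pairing with \<xi>, and metric skew-symmetry moves the curvature onto
  \<xi>.\<close>

lemma eta_R:
  assumes "smooth_vf A X" "smooth_vf A Y" "smooth_vf A Z"
  shows "\<eta> p (R X Y Z p) = \<eta> p (Y p) * g p (X p) (Z p) - \<eta> p (X p) * g p (Y p) (Z p)"
  using R_metric_skew[OF assms xi_smooth, of p]
  by (simp add: g_xi R_xi assms g_diff g_scaleR g_sym[of p "Z p"])

text \<open>On horizontal fields \<open>g (R \<xi> Y Z) V\<close> is symmetric in \<open>Y, Z\<close> by Bianchi and
  skew in \<open>Z, V\<close>.\<close>

lemma R_xi_horizontal:
  assumes sm: "smooth_vf A Y" "smooth_vf A Z" "smooth_vf A V"
    and hor: "\<eta> p (Y p) = 0" "\<eta> p (Z p) = 0" "\<eta> p (V p) = 0"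
  shows "g p (R \<xi> Y Z p) (V p) = 0"
proof -
  have sym: "R \<xi> Y Z p = R \<xi> Z Y p"
    if "smooth_vf A Y" "smooth_vf A Z" "\<eta> p (Y p) = 0" "\<eta> p (Z p) = 0" for Y Z
    using bianchi[OF xi_smooth that(1,2), of p] R_xi[OF that(1,2), of p]
      fun_cong[OF R_skew[OF xi_smooth that(2,1)], of p] that(3,4) by simp
  have skew: "g p (R \<xi> Y Z p) (V p) = - g p (R \<xi> Y V p) (Z p)"
    if "smooth_vf A Y" "smooth_vf A Z" "smooth_vf A V" for Y Z V
    using R_metric_skew[OF xi_smooth that, of p] g_sym[of p "Z p"] by simp
  \<comment> \<open>Each cyclic shift of Y, Z, V costs one sign; three shifts return to the start
    with the opposite sign.\<close>
  have "g p (R \<xi> Y Z p) (V p) = - g p (R \<xi> Z V p) (Y p)"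
    using sym[OF sm(1,2) hor(1,2)] skew[OF sm(2,1,3)] by simp
  also have "\<dots> = g p (R \<xi> V Y p) (Z p)"
    using sym[OF sm(2,3) hor(2,3)] skew[OF sm(3,2,1)] by simp
  also have "\<dots> = - g p (R \<xi> Y Z p) (V p)"
    using sym[OF sm(3,1) hor(3,1)] skew[OF sm(1,3,2)] by simp
  finally show ?thesis by simp
qed

section \<open>Non-null horizontal frames, traces and the Ricci tensor\<close>

lemma ex_non_null_horizontal: "\<exists>e. \<eta> p e = 0 \<and> g p e e \<noteq> 0"
proof -
  have "dim (span {\<xi> p}) \<le> 1" using dim_le_card'[of "{\<xi> p}"] by simp
  moreover have "dim (UNIV :: (real ^ 3) set) = 3" by simp
  ultimately have "span {\<xi> p} \<noteq> UNIV" by (metis numeral_le_one_iff semiring_norm(70))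
  then obtain v where "v \<notin> span {\<xi> p}" by blast
  moreover have "\<eta> p v *\<^sub>R \<xi> p \<in> span {\<xi> p}" by (simp add: span_base span_scale)
  ultimately have v: "v - \<eta> p v *\<^sub>R \<xi> p \<noteq> 0" by auto
  define u where "u = v - \<eta> p v *\<^sub>R \<xi> p"
  have u: "\<eta> p u = 0" by (simp add: u_def eta_simps eta_xi)
  obtain w where w: "g p u w \<noteq> 0"
    using v metric unfolding u_def pseudo_riemannian_def by blast
  \<comment> \<open>As \<open>u\<close> is orthogonal to \<xi>, removing the \<xi> part of
    \<open>w\<close> leaves the pairing with \<open>u\<close> unchanged.\<close>
  define w' where "w' = w - \<eta> p w *\<^sub>R \<xi> p"
  have w': "\<eta> p w' = 0" "g p u w' \<noteq> 0"
    using w u by (simp_all add: w'_def eta_simps eta_xi g_diff g_scaleR g_xi)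
  \<comment> \<open>Polarisation: the mixed term is nonzero, so \<open>u\<close>, \<open>w'\<close>
    and \<open>u + w'\<close> cannot all be null.\<close>
  have "g p (u + w') (u + w') = g p u u + 2 * g p u w' + g p w' w'"
    by (simp add: g_add g_sym[of p w' u])
  then have "g p u u \<noteq> 0 \<or> g p w' w' \<noteq> 0 \<or> g p (u + w') (u + w') \<noteq> 0" using w'(2) by auto
  then show ?thesis using u w'(1) eta_simps(1)[of p u w'] by auto
qed

text \<open>\<open>L\<close> collects the pairings with the frame. The frame shows that it is onto,
  hence injective as an endomorphism of a finite-dimensional space, and it agrees on both
  sides.\<close>

lemma frame_expansion:
  assumes e: "\<eta> p e = 0" "g p e e \<noteq> 0"
  shows "g p e e *\<^sub>R v
    = g p v e *\<^sub>R e - g p v (\<phi> p e) *\<^sub>R \<phi> p e + (g p e e * \<eta> p v) *\<^sub>R \<xi> p"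
proof -
  define L :: "real ^ 3 \<Rightarrow> real ^ 3" where "L = (\<lambda>u. vector [g p u e, g p u (\<phi> p e), \<eta> p u])"
  have lin: "linear L"
    by (rule linearI) (simp_all add: L_def vec_eq_iff forall_3 g_add g_scaleR eta_simps)
  have pp: "g p (\<phi> p e) (\<phi> p e) = - g p e e" by (simp add: g_phi_phi e)
  have pe: "g p (\<phi> p e) e = 0" using g_phi_self[of p e] by (simp add: g_sym)
  have "surj L" unfolding surj_def
  proof
    fix y :: "real ^ 3"
    have "y = L ((y $ 1 / g p e e) *\<^sub>R e - (y $ 2 / g p e e) *\<^sub>R \<phi> p e + (y $ 3) *\<^sub>R \<xi> p)"
      by (simp add: L_def vec_eq_iff forall_3 g_add g_diff g_scaleR eta_simps g_xi eta_xi eta_phi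
          e pp pe g_phi_self)
    then show "\<exists>u. y = L u" by blast
  qed
  then have inj: "inj L" using linear_surjective_imp_injective[OF lin] by simp
  have "L (g p e e *\<^sub>R v) = L (g p v e *\<^sub>R e - g p v (\<phi> p e) *\<^sub>R \<phi> p e + (g p e e * \<eta> p v) *\<^sub>R \<xi> p)"
    by (simp add: L_def vec_eq_iff forall_3 g_add g_diff g_scaleR eta_simps g_xi eta_xi eta_phi
        e pp pe g_phi_self)
  then show ?thesis using inj by (simp add: inj_eq)
qed

text \<open>Expanding each standard basis vector in the frame turns the diagonal sum into a sum over
  the frame of the dual functional applied to \<open>L\<close> of the frame vector.\<close>

lemma trace_frame:
  assumes e: "\<eta> p e = 0" "g p e e \<noteq> 0" and L: "linear L"
  shows "g p e e * trace (matrix L)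
    = g p (L e) e - g p (L (\<phi> p e)) (\<phi> p e) + g p e e * \<eta> p (L (\<xi> p))"
proof -
  have entry: "g p e e * (L u $ i) = g p u e * L e $ i - g p u (\<phi> p e) * L (\<phi> p e) $ i
      + (g p e e * \<eta> p u) * L (\<xi> p) $ i" for u i
  proof -
    have "g p e e *\<^sub>R L u = L (g p e e *\<^sub>R u)" by (simp add: linear_cmul[OF L])
    also have "\<dots> = g p u e *\<^sub>R L e - g p u (\<phi> p e) *\<^sub>R L (\<phi> p e) + (g p e e * \<eta> p u) *\<^sub>R L (\<xi> p)"
      by (simp only: frame_expansion[OF e, of u] linear_add[OF L] linear_diff[OF L] linear_cmul[OF L])
    finally show ?thesis by (auto dest!: arg_cong[where f = "\<lambda>x. x $ i"])
  qed
  have gl: "linear (\<lambda>u. g p u w)" for w by (rule linearI) (simp_all add: g_add g_scaleR)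
  have "g p e e * trace (matrix L) = (\<Sum>i\<in>UNIV. g p e e * (L (axis i 1) $ i))"
    by (simp add: trace_def matrix_def sum_distrib_left)
  also have "\<dots> = (\<Sum>i\<in>UNIV. g p (axis i 1) e * L e $ i)
      - (\<Sum>i\<in>UNIV. g p (axis i 1) (\<phi> p e) * L (\<phi> p e) $ i)
      + g p e e * (\<Sum>i\<in>UNIV. \<eta> p (axis i 1) * L (\<xi> p) $ i)"
    by (simp only: entry sum.distrib sum_subtractf sum_distrib_left mult.assoc)
  also have "\<dots> = g p (L e) e - g p (L (\<phi> p e)) (\<phi> p e) + g p e e * \<eta> p (L (\<xi> p))"
    by (simp only: linear_functional_expand[OF gl] linear_functional_expand[OF eta_linear])
  finally show ?thesis .
qed

text \<open>Tensoriality makes \<open>v \<mapsto> R(v, Y)Z\<close> linear although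
  \<open>extend_vec\<close> is a mere choice. \<open>Y\<close> and \<open>Z\<close> are arbitrary
  here since the formula is also applied to \<open>nab W Y\<close> and \<open>nab W Z\<close>, which
  may have \<xi> components.\<close>

lemma ricci_frame:
  assumes E: "smooth_vf A E" "\<eta> q (E q) = 0" "g q (E q) (E q) \<noteq> 0"
    and Y: "smooth_vf A Y" and Z: "smooth_vf A Z"
  shows "g q (E q) (E q) * ricci A nab Y Z q
    = g q (R E Y Z q) (E q) - g q (R (\<lambda>r. \<phi> r (E r)) Y Z q) (\<phi> q (E q))
      + g q (E q) (E q) * (\<eta> q (Y q) * \<eta> q (Z q) - g q (Y q) (Z q))"
proof -
  define L where "L = (\<lambda>v. R (extend_vec A q v) Y Z q)"
  have "linear L"
  proof (rule linearI)
    fix u v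
    show "L (u + v) = L u + L v"
      unfolding L_def
      using R_combination[OF extend_vec(1)[of q "u + v"] extend_vec(1)[of q u] extend_vec(1)[of q v]
          xi_smooth Y Z, of q 1 1 0] by (simp add: extend_vec(2))
  next
    fix c v
    show "L (c *\<^sub>R v) = c *\<^sub>R L v"
      unfolding L_def
      using R_combination[OF extend_vec(1)[of q "c *\<^sub>R v"] extend_vec(1)[of q v] xi_smooth
          xi_smooth Y Z, of q c 0 0] by (simp add: extend_vec(2))
  qed
  note tr = trace_frame[OF E(2,3) this]
  have L: "L (X q) = R X Y Z q" if "smooth_vf A X" for X
    unfolding L_def by (rule R_cong[OF extend_vec(1) that Y Z extend_vec(2)])
  have "ricci A nab Y Z q = trace (matrix L)" by (simp add: ricci_def L_def)
  then show ?thesis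
    using tr L[OF E(1)] L[OF phi_smooth[OF E(1)]] L[OF xi_smooth]
    by (simp add: eta_R[OF xi_smooth Y Z] g_xi eta_xi)
qed

text \<open>Differentiate the frame formula for \<open>ricci\<close> and compare with the Leibniz
  expansion of both \<open>nabla_curvature\<close> terms. The two sides differ only in how the
  derivatives of the frame and of \<open>g E E\<close> enter.\<close>

lemma nabla_ricci_frame:
  assumes W: "smooth_vf A W" and E: "smooth_vf A E" "\<And>q. \<eta> q (E q) = 0" and h: "g p (E p) (E p) \<noteq> 0"
    and Y: "smooth_vf A Y" "\<And>q. \<eta> q (Y q) = 0" and Z: "smooth_vf A Z" "\<And>q. \<eta> q (Z q) = 0"
  shows "g p (E p) (E p) * nabla_ricci A nab W Y Z p
    = g p (nabla_curvature A nab W E Y Z p) (E p)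
      - g p (nabla_curvature A nab W (\<lambda>q. \<phi> q (E q)) Y Z p) (\<phi> p (E p))"
proof -
  define F where "F = (\<lambda>q. \<phi> q (E q))"
  have F: "smooth_vf A F" "\<And>q. \<eta> q (F q) = 0"
    unfolding F_def by (rule phi_smooth[OF E(1)]) (simp add: eta_phi)
  have phiF: "\<phi> q (F q) = E q" for q by (simp add: F_def phi_phi E(2))
  note WE = nab_smooth[OF W E(1)] and WF = nab_smooth[OF W F(1)]
    and WY = nab_smooth[OF W Y(1)] and WZ = nab_smooth[OF W Z(1)]
    and RE = R_smooth[OF E(1) Y(1) Z(1)] and RF = R_smooth[OF F(1) Y(1) Z(1)]
  define h where "h = (\<lambda>q. g q (E q) (E q))"
  define f where "f = (\<lambda>q. g q (R E Y Z q) (E q) - g q (R F Y Z q) (F q) - h q * g q (Y q) (Z q))"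
  have hp: "h p \<noteq> 0" using assms(4) by (simp add: h_def)
  have hs: "smooth_fun A h" unfolding h_def by (rule g_smooth[OF E(1) E(1)])
  have fs: "smooth_fun A f" unfolding f_def
    by (intro smooth_fun_diff smooth_fun_mult hs g_smooth RE RF E(1) F(1) Y(1) Z(1))
  have ric: "h q * ricci A nab Y Z q = f q" if "h q \<noteq> 0" for q
    using ricci_frame[OF E(1) E(2) _ Y(1) Z(1), of q] that
    by (simp add: h_def f_def F_def Y(2) algebra_simps)
  \<comment> \<open>\<open>frame_expansion\<close> of \<open>nab W E p\<close> solved by division by
    \<open>h p\<close>; the sign in \<open>b\<close> reflects g(F, F) = -h.\<close>
  define a where "a = g p (nab W E p) (E p) / h p"
  define b where "b = - g p (nab W E p) (F p) / h p"
  define c where "c = \<eta> p (nab W E p)"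
  define d where "d = g p (W p) (E p)"
  have hE: "g p (E p) (E p) = h p" by (simp add: h_def)
  have "h p *\<^sub>R nab W E p = h p *\<^sub>R (a *\<^sub>R E p + b *\<^sub>R F p + c *\<^sub>R \<xi> p)"
    using frame_expansion[OF E(2) assms(4), of "nab W E p"] hp
    by (simp add: a_def b_def c_def F_def hE scaleR_add_right scaleR_diff_right)
  then have nabE: "nab W E p = a *\<^sub>R E p + b *\<^sub>R F p + c *\<^sub>R \<xi> p" using hp by (metis scaleR_left_imp_eq)
  \<comment> \<open>\<phi> exchanges E and F, so \<open>a\<close> and \<open>b\<close> trade places,
    and it kills \<xi>; the new \<xi> term is that of the structure equation.\<close>
  have nabF: "nab W F p = b *\<^sub>R E p + a *\<^sub>R F p + d *\<^sub>R \<xi> p"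
    unfolding F_def nab_phi[OF W E(1)]
    by (simp add: nabE phi_simps phi_xi phiF E(2) d_def F_def[symmetric])
  define rEE where "rEE = g p (R E Y Z p) (E p)"
  define rEF where "rEF = g p (R E Y Z p) (F p)"
  define rFE where "rFE = g p (R F Y Z p) (E p)"
  define rFF where "rFF = g p (R F Y Z p) (F p)"
  \<comment> \<open>These remove \<open>c\<close> and \<open>d\<close>: \<open>z1\<close> where the
    frame derivative enters the curvature, \<open>z2\<close> where it is paired with it.\<close>
  have z1: "g p (R \<xi> Y Z p) (E p) = 0" "g p (R \<xi> Y Z p) (F p) = 0"
    using R_xi_horizontal[OF Y(1) Z(1)] E F Y(2) Z(2) by simp_all
  have z2: "g p (R E Y Z p) (\<xi> p) = 0" "g p (R F Y Z p) (\<xi> p) = 0"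
    by (simp_all add: g_xi eta_R E F Y Z)
  have RnabE: "R (nab W E) Y Z p = a *\<^sub>R R E Y Z p + b *\<^sub>R R F Y Z p + c *\<^sub>R R \<xi> Y Z p"
    by (rule R_combination[OF WE E(1) F(1) xi_smooth Y(1) Z(1) nabE])
  have RnabF: "R (nab W F) Y Z p = b *\<^sub>R R E Y Z p + a *\<^sub>R R F Y Z p + d *\<^sub>R R \<xi> Y Z p"
    by (rule R_combination[OF WF E(1) F(1) xi_smooth Y(1) Z(1) nabF])
  have "vf_apply A W h p = g p (nab W E p) (E p) + g p (E p) (nab W E p)"
    unfolding h_def nab_metric[OF W E(1) E(1)] ..
  then have Wh: "vf_apply A W h p = 2 * a * h p"
    using hp g_sym[of p "E p" "nab W E p"] by (simp add: a_def)
  have Wf: "vf_apply A W f p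
      = g p (nab W (R E Y Z) p) (E p) + g p (R E Y Z p) (nab W E p)
      - (g p (nab W (R F Y Z) p) (F p) + g p (R F Y Z p) (nab W F p))
      - (h p * (g p (nab W Y p) (Z p) + g p (Y p) (nab W Z p)) + vf_apply A W h p * g p (Y p) (Z p))"
    unfolding f_def
      vf_apply_diff[OF smooth_fun_diff[OF g_smooth[OF RE E(1)] g_smooth[OF RF F(1)]]
        smooth_fun_mult[OF hs g_smooth[OF Y(1) Z(1)]]]
      vf_apply_diff[OF g_smooth[OF RE E(1)] g_smooth[OF RF F(1)]]
      vf_apply_mult[OF hs g_smooth[OF Y(1) Z(1)]]
      nab_metric[OF W RE E(1)] nab_metric[OF W RF F(1)] nab_metric[OF W Y(1) Z(1)] ..
  \<comment> \<open>\<open>ric\<close> holds only where \<open>h\<close> is nonzero, which suffices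
    for the derivative at \<open>p\<close>.\<close>
  have quot: "vf_apply A W f p = h p * vf_apply A W (ricci A nab Y Z) p + vf_apply A W h p * ricci A nab Y Z p"
    unfolding vf_apply_def
    by (rule dif_quotient[where W = UNIV]) (use fs hs hp ric in \<open>simp_all add: smooth_fun_def\<close>)
  have ricY: "h p * ricci A nab (nab W Y) Z p
      = g p (R E (nab W Y) Z p) (E p) - g p (R F (nab W Y) Z p) (F p) - h p * g p (nab W Y p) (Z p)"
    using ricci_frame[OF E(1) E(2) assms(4) WY Z(1)] by (simp add: h_def F_def Z(2) algebra_simps)
  have ricZ: "h p * ricci A nab Y (nab W Z) p
      = g p (R E Y (nab W Z) p) (E p) - g p (R F Y (nab W Z) p) (F p) - h p * g p (Y p) (nab W Z p)"
    using ricci_frame[OF E(1) E(2) assms(4) Y(1) WZ] by (simp add: h_def F_def Y(2) algebra_simps)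
  have ricp: "h p * ricci A nab Y Z p = rEE - rFF - h p * g p (Y p) (Z p)"
    using ric[OF hp] by (simp add: f_def rEE_def rFF_def)
  have WhRic: "vf_apply A W h p * ricci A nab Y Z p = 2 * a * (rEE - rFF - h p * g p (Y p) (Z p))"
    using ricp by (simp add: Wh)
  have PE: "g p (nabla_curvature A nab W E Y Z p) (E p)
      = g p (nab W (R E Y Z) p) (E p) - (a * rEE + b * rFE)
      - g p (R E (nab W Y) Z p) (E p) - g p (R E Y (nab W Z) p) (E p)"
    by (simp add: nabla_curvature_def RnabE g_diff g_add g_scaleR z1 rEE_def rFE_def)
  have PF: "g p (nabla_curvature A nab W F Y Z p) (F p)
      = g p (nab W (R F Y Z) p) (F p) - (b * rEF + a * rFF)
      - g p (R F (nab W Y) Z p) (F p) - g p (R F Y (nab W Z) p) (F p)"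
    by (simp add: nabla_curvature_def RnabF g_diff g_add g_scaleR z1 rEF_def rFF_def)
  have REn: "g p (R E Y Z p) (nab W E p) = a * rEE + b * rEF"
    "g p (R F Y Z p) (nab W F p) = b * rFE + a * rFF"
    by (simp_all add: nabE nabF g_add g_scaleR z2 rEE_def rEF_def rFE_def rFF_def)
  \<comment> \<open>The \<open>b\<close> terms agree on both sides. The \<open>a\<close> terms agree
    once the derivative \<open>2 * a * h p\<close> of \<open>h\<close> is taken into account, and
    everything containing \<open>g p (Y p) (Z p)\<close> or its derivative cancels.\<close>
  have "h p * nabla_ricci A nab W Y Z p
      = g p (nabla_curvature A nab W E Y Z p) (E p) - g p (nabla_curvature A nab W F Y Z p) (F p)"
    using quot[unfolded WhRic Wf REn, unfolded Wh] ricY ricZ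
    unfolding PE PF nabla_ricci_def by (simp add: algebra_simps)
  then show ?thesis by (simp add: h_def F_def)
qed

lemma locally_phi_symmetric_if_eta_parallel:
  assumes "eta_parallel_ricci A \<phi> nab"
  shows "locally_phi_symmetric A \<phi> \<xi> g nab"
  unfolding locally_phi_symmetric_def
proof (intro allI impI)
  fix W X Y Z p
  assume "horizontal_vf A g \<xi> W" "horizontal_vf A g \<xi> X" "horizontal_vf A g \<xi> Y" "horizontal_vf A g \<xi> Z"
  then have W: "smooth_vf A W" and X: "smooth_vf A X" "\<And>q. \<eta> q (X q) = 0"
    and Y: "smooth_vf A Y" "\<And>q. \<eta> q (Y q) = 0" and Z: "smooth_vf A Z" "\<And>q. \<eta> q (Z q) = 0"
    by (simp_all add: horizontal_vf_def g_xi)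
  let ?P = "nabla_curvature A nab W"
  have ric0: "nabla_ricci A nab W Y Z p = 0"
    if "smooth_vf A Y" "\<And>q. \<eta> q (Y q) = 0" "smooth_vf A Z" "\<And>q. \<eta> q (Z q) = 0" for Y Z
  proof -
    have "(\<lambda>q. \<phi> q (\<phi> q (Y q))) = Y" "(\<lambda>q. \<phi> q (\<phi> q (Z q))) = Z"
      using that(2,4) by (simp_all add: phi_phi)
    moreover have "nabla_ricci A nab W (\<lambda>q. \<phi> q (\<phi> q (Y q))) (\<lambda>q. \<phi> q (\<phi> q (Z q))) p = 0"
      using assms[unfolded eta_parallel_ricci_def, rule_format,
          OF W phi_smooth[OF that(1)] phi_smooth[OF that(3)]] .
    ultimately show ?thesis by simp
  qed
  obtain e where e: "\<eta> p e = 0" "g p e e \<noteq> 0" using ex_non_null_horizontal by blast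
  \<comment> \<open>The extension of \<open>e\<close> is projected to the horizontal spaces, so E is
    horizontal everywhere but known to be non-null only at \<open>p\<close>.\<close>
  define E where "E = (\<lambda>q. extend_vec A p e q - \<eta> q (extend_vec A p e q) *\<^sub>R \<xi> q)"
  define F where "F = (\<lambda>q. \<phi> q (E q))"
  have E: "smooth_vf A E" "\<And>q. \<eta> q (E q) = 0"
    unfolding E_def
    by (intro smooth_vf_diff smooth_vf_scaleR eta_smooth xi_smooth extend_vec(1))
      (simp add: eta_simps eta_xi)
  have "E p = e" by (simp add: E_def extend_vec(2) e)
  then have Ep: "g p (E p) (E p) \<noteq> 0" using e by simp
  have F: "smooth_vf A F" "\<And>q. \<eta> q (F q) = 0"
    unfolding F_def by (rule phi_smooth[OF E(1)]) (simp add: eta_phi)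
  define T where "T = ?P E F Z p"
  have skew0: "?P V V Z p = 0" if "smooth_vf A V" for V
  proof -
    have "2 *\<^sub>R ?P V V Z p = 0"
      using nabla_R_skew[OF W that that Z(1), of p] unfolding scaleR_2 by (metis add.right_inverse)
    then show ?thesis by (simp only: scaleR_eq_0_iff) simp
  qed
  have FE: "?P F E Z p = - T" unfolding T_def by (rule nabla_R_skew[OF W E(1) F(1) Z(1)])
  have "g p T (F p) = 0"
    using nabla_ricci_frame[OF W E Ep E Z] ric0[OF E Z] skew0[OF E(1)] FE
    by (simp add: F_def[symmetric] g_zero g_minus) (simp add: F_def)
  moreover have "g p T (E p) = 0"
    using nabla_ricci_frame[OF W E Ep F Z] ric0[OF F Z] skew0[OF F(1)]
    by (simp add: F_def[symmetric] g_zero T_def)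
  ultimately have "g p (E p) (E p) *\<^sub>R T = (g p (E p) (E p) * \<eta> p T) *\<^sub>R \<xi> p"
    using frame_expansion[OF E(2) Ep, of T] by (simp add: F_def)
  \<comment> \<open>T is now a multiple of \<xi>, which \<phi> annihilates.\<close>
  then have "g p (E p) (E p) *\<^sub>R \<phi> p T = 0"
    by (metis phi_simps(2) phi_xi scaleR_zero_right)
  then have T: "\<phi> p T = 0" using Ep by simp
  have comb: "\<exists>a b. V p = a *\<^sub>R E p + b *\<^sub>R F p + 0 *\<^sub>R \<xi> p" if "\<eta> p (V p) = 0" for V
  proof -
    have "V p = (1 / g p (E p) (E p)) *\<^sub>R (g p (E p) (E p) *\<^sub>R V p)" using Ep by simp
    also have "\<dots> = (g p (V p) (E p) / g p (E p) (E p)) *\<^sub>R E p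
        + (- g p (V p) (F p) / g p (E p) (E p)) *\<^sub>R F p + 0 *\<^sub>R \<xi> p"
      unfolding frame_expansion[OF E(2) Ep, of "V p"] that F_def by (simp add: scaleR_diff_right)
    finally show ?thesis by blast
  qed
  obtain a b where Xp: "X p = a *\<^sub>R E p + b *\<^sub>R F p + 0 *\<^sub>R \<xi> p" using comb[of X, OF X(2)] by blast
  obtain c d where Yp: "Y p = c *\<^sub>R E p + d *\<^sub>R F p + 0 *\<^sub>R \<xi> p" using comb[of Y, OF Y(2)] by blast
  have PY: "?P V Y Z p = - (c *\<^sub>R ?P E V Z p + d *\<^sub>R ?P F V Z p)" if V: "smooth_vf A V" for V
    using nabla_R_skew[OF W Y(1) V Z(1), of p]
      nabla_R_combination[OF W Y(1) E(1) F(1) xi_smooth V Z(1) Yp] by simp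
  have "?P X Y Z p = a *\<^sub>R ?P E Y Z p + b *\<^sub>R ?P F Y Z p"
    using nabla_R_combination[OF W X(1) E(1) F(1) xi_smooth Y(1) Z(1) Xp] by simp
  \<comment> \<open>An alternating bilinear map on the horizontal plane: the factor is the
    determinant of X, Y with respect to E, F.\<close>
  also have "\<dots> = (a * d - b * c) *\<^sub>R T"
    unfolding PY[OF E(1)] PY[OF F(1)] skew0[OF E(1)] skew0[OF F(1)] FE
    by (simp add: T_def[symmetric] algebra_simps)
  finally show "\<phi> p (\<phi> p (?P X Y Z p)) = 0" by (simp add: phi_simps T)
qed

end

theorem theorem6p7:
  fixes A :: "('m::{t2_space, second_countable_topology}, 3) chart set"
    and \<phi> :: "'m \<Rightarrow> real ^ 3 \<Rightarrow> real ^ 3"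
    and \<eta> :: "'m \<Rightarrow> real ^ 3 \<Rightarrow> real"
    and \<xi> :: "('m, 3) vfield"
    and g :: "'m \<Rightarrow> real ^ 3 \<Rightarrow> real ^ 3 \<Rightarrow> real"
    and nab :: "('m, 3) conn"
  assumes "quasi_para_Sasakian A \<phi> \<eta> \<xi> g nab"
    and "eta_parallel_ricci A \<phi> nab"
  shows "locally_phi_symmetric A \<phi> \<xi> g nab"
proof -
  interpret quasi_para_Sasakian_3 A \<phi> \<eta> \<xi> g nab
    using assms(1) by unfold_locales (auto simp: quasi_para_Sasakian_def almost_paracontact_metric_def)
  show ?thesis by (rule locally_phi_symmetric_if_eta_parallel[OF assms(2)])
qed

end
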